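(* $$\sup_{\mu,\,M\ge 0} \inf_{K\ge 0} C_1(K,M,{\cal P}(\mu))\le \frac{1}{2},\quad \sup_{\mu,\,M\ge 0} \inf_{K\ge 0} C_0(K,M,{\cal P}(\mu))= 0.$$
   Context: Let $D\subseteq\mathbb{R}^n$ be open, either $D=\mathbb{R}^n$ or bounded with $C^2$ boundary; $T>0$, $Q=D\times(0,T)$. Let $H^0=L_2(D)$, $H^1$ the closure in $W_2^1(D)$ of smooth functions vanishing on $\partial D$, $H^{-1}$ its dual, $X^k=L^2([0,T];H^k)$, and $Y^1=X^1\cap C([0,T];H^0)$. Consider the problem $\partial u/\partial t={\cal A}u+\varphi$ on $Q$, $u(x,0)=0$, $u|_{\partial D}=0$, where ${\cal A}y=\sum_{i}\partial_{x_i}\sum_j (b_{ij}(x,t)\partial_{x_j}y)+\sum_i f_i(x,t)\partial_{x_i}y+\lambda(x,t)y$, with $b=b^\top$, $f$, $\lambda$ measurable, $\xi^\top b(x,t)\xi\ge\delta|\xi|^2$ for some $\delta>0$, and $\mathrm{ess\,sup}_Q[|b|+|b^{-1}|+|f|+|\lambda|]<\infty$. Let $\mu=(T,n,D,\delta,b,f,\lambda)$ range over all such admissible data and ${\cal P}(\mu)=(T,n,D,\delta,\mathrm{ess\,sup}_Q[|b|+|f|+|\lambda|])$. For $\varphi\in X^{-1}$ write $\varphi=\nabla\cdot F+F_0$ with $F=(F_1,\dots,F_n)$, $F_k\in L_2(Q)$, $k=0,\dots,n$; the problem has a unique solution $u\in Y^1$. For $K\in\mathbb{R}$, $M\ge0$,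 let $C_i(K,M,{\cal P})$ ($i=0,1$) be the infimum of constants $\tilde C_i$ such that for all $\varphi\in X^{-1}$ and $t\in(0,T]$: $e^{-2Kt}\|u(\cdot,t)\|^2_{H^0}+M\int_0^t e^{-2Ks}\|u(\cdot,s)\|^2_{H^0}ds\le\tilde C_1\int_0^t e^{-2Ks}(F(\cdot,s),b(\cdot,s)^{-1}F(\cdot,s))_{H^0}ds+\tilde C_0\int_0^te^{-2Ks}\|F_0(\cdot,s)\|^2_{H^0}ds$. *)

theory Defs
  imports "HOL-Analysis.Analysis"
begin

definition QM :: "((real^'n) \<times> real) measure" where
  "QM = lborel \<Otimes>\<^sub>M lborel"

fun pd :: "'n list \<Rightarrow> (real^'n::finite \<Rightarrow> real) \<Rightarrow> real^'n \<Rightarrow> real" where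
  "pd [] g = g"
| "pd (i # is) g = (\<lambda>x. deriv (\<lambda>s. pd is g (x + s *\<^sub>R axis i 1)) 0)"

definition smooth_fun :: "(real^'n::finite \<Rightarrow> real) \<Rightarrow> bool" where
  "smooth_fun g \<longleftrightarrow>
     (\<forall>is. continuous_on UNIV (pd is g) \<and>
       (\<forall>x i. (\<lambda>s. pd is g (x + s *\<^sub>R axis i 1)) differentiable (at 0)))"

definition grad :: "(real^'n::finite \<Rightarrow> real) \<Rightarrow> real^'n \<Rightarrow> real^'n" where
  "grad g x = (\<chi> i. pd [i] g x)"

definition testfun :: "(real^'n::finite) set \<Rightarrow> (real^'n \<Rightarrow> real) \<Rightarrow> bool" where
  "testfun D g \<longleftrightarrow> smooth_fun g \<and>
     (\<exists>K. compact K \<and> K \<subseteq> D \<and> (\<forall>x. x \<notin> K \<longrightarrow> g x = 0))"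

text \<open>H10 D v w: v belongs to H^1 and w is its (weak) gradient, i.e. (v,w) is an L2-limit
  of (phi_k, grad phi_k) for test functions phi_k on D.\<close>
definition H10 :: "(real^'n::finite) set \<Rightarrow> (real^'n \<Rightarrow> real) \<Rightarrow> (real^'n \<Rightarrow> real^'n) \<Rightarrow> bool" where
  "H10 D v w \<longleftrightarrow>
     set_integrable lborel D (\<lambda>x. (v x)\<^sup>2) \<and>
     set_integrable lborel D (\<lambda>x. (norm (w x))\<^sup>2) \<and>
     (\<exists>\<phi>. (\<forall>k. testfun D (\<phi> k)) \<and>
        (\<lambda>k. LINT x:D|lborel. (\<phi> k x - v x)\<^sup>2) \<longlonglongrightarrow> 0 \<and>
        (\<lambda>k. LINT x:D|lborel. (norm (grad (\<phi> k) x - w x))\<^sup>2) \<longlonglongrightarrow> 0)"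

definition C2_boundary :: "(real^'n::finite) set \<Rightarrow> bool" where
  "C2_boundary D \<longleftrightarrow>
     (\<forall>p\<in>frontier D. \<exists>r>0. \<exists>(\<psi>::real^'n \<Rightarrow> real) (g::real^'n \<Rightarrow> real^'n) (H::real^'n \<Rightarrow> real^'n^'n).
        (\<forall>x. (\<psi> has_derivative (\<lambda>h. g x \<bullet> h)) (at x)) \<and>
        (\<forall>x. (g has_derivative (\<lambda>h. H x *v h)) (at x)) \<and>
        continuous_on UNIV H \<and>
        (\<forall>x\<in>ball p r. g x \<noteq> 0) \<and>
        D \<inter> ball p r = {x\<in>ball p r. \<psi> x < 0})"

definition esssupQ :: "((real^'n::finite) \<times> real) set \<Rightarrow> ((real^'n) \<times> real \<Rightarrow> real) \<Rightarrow> ereal" where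
  "esssupQ Q h = Inf {c. AE z in QM. z \<in> Q \<longrightarrow> ereal (h z) \<le> c}"

type_synonym 'n data =
  "real \<times> (real^'n) set \<times> real \<times> (real^'n \<Rightarrow> real \<Rightarrow> real^'n^'n)
     \<times> (real^'n \<Rightarrow> real \<Rightarrow> real^'n) \<times> (real^'n \<Rightarrow> real \<Rightarrow> real)"

text \<open>mu = (T, D, delta, b, f, lambda); the dimension n is the type 'n.\<close>
definition admissible :: "('n::finite) data \<Rightarrow> bool" where
  "admissible \<mu> = (case \<mu> of (T, D, \<delta>, b, f, lam) \<Rightarrow>
     T > 0 \<and> \<delta> > 0 \<and> open D \<and> (D = UNIV \<or> (bounded D \<and> C2_boundary D)) \<and>
     (\<lambda>(x,t). b x t) \<in> borel_measurable QM \<and>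
     (\<lambda>(x,t). f x t) \<in> borel_measurable QM \<and>
     (\<lambda>(x,t). lam x t) \<in> borel_measurable QM \<and>
     (AE z in QM. z \<in> D \<times> {0<..<T} \<longrightarrow>
        transpose (b (fst z) (snd z)) = b (fst z) (snd z) \<and>
        (\<forall>\<xi>. \<xi> \<bullet> (b (fst z) (snd z) *v \<xi>) \<ge> \<delta> * (norm \<xi>)\<^sup>2)) \<and>
     esssupQ (D \<times> {0<..<T})
        (\<lambda>(x,t). norm (b x t) + norm (matrix_inv (b x t)) + norm (f x t) + \<bar>lam x t\<bar>) < \<infinity>)"

text \<open>The data P(mu) = (T, n, D, delta, ess sup (|b|+|f|+|lambda|)); n is the type.\<close>
definition Pof :: "('n::finite) data \<Rightarrow> real \<times> (real^'n) set \<times> real \<times> ereal" where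
  "Pof \<mu> = (case \<mu> of (T, D, \<delta>, b, f, lam) \<Rightarrow>
     (T, D, \<delta>, esssupQ (D \<times> {0<..<T}) (\<lambda>(x,t). norm (b x t) + norm (f x t) + \<bar>lam x t\<bar>)))"

section \<open>The solution in Y^1 of du/dt = A u + div F + F0, u(0)=0, u=0 on the boundary\<close>

definition L2Q :: "((real^'n::finite) \<times> real) set \<Rightarrow> (real^'n \<Rightarrow> real \<Rightarrow> 'a::euclidean_space) \<Rightarrow> bool" where
  "L2Q Q F \<longleftrightarrow> (\<lambda>(x,t). F x t) \<in> borel_measurable QM \<and>
     set_integrable QM Q (\<lambda>(x,t). (norm (F x t))\<^sup>2)"

text \<open>u is the solution (continuous representative in time with values in L2(D)), Du its
  spatial gradient.  The equation is imposed in the weak, time-integrated form, which also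
  encodes u(.,0) = 0; the Dirichlet condition is encoded by u(.,t) in H^1.\<close>
definition is_solution ::
  "real \<Rightarrow> (real^'n::finite) set \<Rightarrow> (real^'n \<Rightarrow> real \<Rightarrow> real^'n^'n) \<Rightarrow> (real^'n \<Rightarrow> real \<Rightarrow> real^'n)
   \<Rightarrow> (real^'n \<Rightarrow> real \<Rightarrow> real) \<Rightarrow> (real^'n \<Rightarrow> real \<Rightarrow> real^'n) \<Rightarrow> (real^'n \<Rightarrow> real \<Rightarrow> real)
   \<Rightarrow> (real^'n \<Rightarrow> real \<Rightarrow> real) \<Rightarrow> (real^'n \<Rightarrow> real \<Rightarrow> real^'n) \<Rightarrow> bool" where
  "is_solution T D b f lam F F0 u Du \<longleftrightarrow>
     L2Q (D \<times> {0<..<T}) u \<and> L2Q (D \<times> {0<..<T}) Du \<and>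
     (AE t in lborel. t \<in> {0<..<T} \<longrightarrow> H10 D (\<lambda>x. u x t) (\<lambda>x. Du x t)) \<and>
     (\<forall>t\<in>{0..T}. set_integrable lborel D (\<lambda>x. (u x t)\<^sup>2)) \<and>
     (\<forall>t\<in>{0..T}. ((\<lambda>s. LINT x:D|lborel. (u x s - u x t)\<^sup>2) \<longlongrightarrow> 0) (at t within {0..T})) \<and>
     (\<forall>t\<in>{0..T}. \<forall>\<psi>. testfun D \<psi> \<longrightarrow>
        (LINT x:D|lborel. u x t * \<psi> x) =
        (LINT z:(D \<times> {0<..<t})|QM. (case z of (x, s) \<Rightarrow>
            - ((b x s *v Du x s) \<bullet> grad \<psi> x)
            + (f x s \<bullet> Du x s + lam x s * u x s) * \<psi> x
            - F x s \<bullet> grad \<psi> x + F0 x s * \<psi> x)))"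

definition energy_ok ::
  "real \<Rightarrow> real \<Rightarrow> real \<times> (real^'n::finite) set \<times> real \<times> ereal \<Rightarrow> real \<Rightarrow> real \<Rightarrow> bool" where
  "energy_ok K M P c1 c0 \<longleftrightarrow>
     (\<forall>\<mu>::'n data. admissible \<mu> \<and> Pof \<mu> = P \<longrightarrow>
       (case \<mu> of (T, D, \<delta>, b, f, lam) \<Rightarrow>
         \<forall>F F0 u Du. L2Q (D \<times> {0<..<T}) F \<and> L2Q (D \<times> {0<..<T}) F0 \<and>
           is_solution T D b f lam F F0 u Du \<longrightarrow>
           (\<forall>t\<in>{0<..T}.
              exp (- 2 * K * t) * (LINT x:D|lborel. (u x t)\<^sup>2)
              + M * (LINT z:(D \<times> {0<..<t})|QM. (case z of (x, s) \<Rightarrow> exp (- 2 * K * s) * (u x s)\<^sup>2))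
              \<le> c1 * (LINT z:(D \<times> {0<..<t})|QM. (case z of (x, s) \<Rightarrow>
                       exp (- 2 * K * s) * (F x s \<bullet> (matrix_inv (b x s) *v F x s))))
               + c0 * (LINT z:(D \<times> {0<..<t})|QM. (case z of (x, s) \<Rightarrow>
                       exp (- 2 * K * s) * (F0 x s)\<^sup>2)))))"

definition C1 :: "real \<Rightarrow> real \<Rightarrow> real \<times> (real^'n::finite) set \<times> real \<times> ereal \<Rightarrow> ereal" where
  "C1 K M P = Inf {ereal c1 | c1 c0. energy_ok K M P c1 c0}"

definition C0 :: "real \<Rightarrow> real \<Rightarrow> real \<times> (real^'n::finite) set \<times> real \<times> ereal \<Rightarrow> ereal" where
  "C0 K M P = Inf {ereal c0 | c1 c0. energy_ok K M P c1 c0}"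

end

theory Submission
  imports Defs
begin

text \<open>
  With \<open>A = (- (b Du + F), f \<bullet> Du + \<lambda> u + F\<^sub>0)\<close> and \<open>W = (Du, u)\<close>, the weak equation gives
  \<open>e\<^sup>-\<^sup>2\<^sup>K\<^sup>t |u(t)|\<^sup>2 + 2 K \<integral> e\<^sup>-\<^sup>2\<^sup>K\<^sup>s |u|\<^sup>2 \<le> 2 \<integral> e\<^sup>-\<^sup>2\<^sup>K\<^sup>s A \<bullet> W\<close>: tested with \<open>u(s)\<close>, the difference
  quotient \<open>(u(s) - u(s - h))/h\<close> becomes an average over \<open>0 < \<rho> < h\<close> of the pairings of
  \<open>A(s - \<rho>)\<close> with \<open>W(s)\<close>, and translations are continuous in \<open>L\<^sup>2\<close>. Pointwise,
  \<open>- 2 F \<bullet> Du \<le> 2 \<theta> Du \<bullet> b Du + F \<bullet> b\<^sup>-\<^sup>1 F / (2 \<theta>)\<close> with \<open>\<theta> = 1 / (1 + 2 \<epsilon>)\<close>, while the drift and \<open>F\<^sub>0\<close> terms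
  are absorbed by \<open>2 (1 - \<theta>) Du \<bullet> b Du\<close>, \<open>\<epsilon> F\<^sub>0\<^sup>2\<close> and a multiple of \<open>u\<^sup>2\<close>. The latter is dominated by
  the term with \<open>2 K\<close> once \<open>K\<close> is large, so the constants \<open>1/2 + \<epsilon>\<close> and \<open>\<epsilon>\<close> are admissible. For the
  heat equation on the whole space, \<open>u = t \<phi>\<close> with a bump \<open>\<phi>\<close> solves the problem with \<open>F = 0\<close>,
  which rules out negative values of the second constant.
\<close>

section \<open>Square integrable functions and translations\<close>

text \<open>Since only an upper bound is wanted, the inequality a^2 - b^2 <= 2 (a - b) a replaces
  that rule: it leaves the difference u(s) - u(s - h) tested with u(s), a function frozen at one
  time. Continuity of \<open>u\<close> in time with values in L^2 recovers the energy at the final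
  time as a one-sided derivative. The constant 1/2 is the limit \<theta> -> 1: Young's inequality
  then spends the entire form Du . b Du on \<open>F\<close>, and nothing is left for f . Du. Any
  \<epsilon> > 0 frees a part of it, at the price of a larger \<open>K\<close>. That
  \<open>K\<close> must serve all data with the same \<open>Pof\<close>, so it may involve \<delta>
  and a bound for |b| + |f| + |lambda| only. The second claim needs a lower bound because the
  constants in \<open>energy_ok\<close> range over all reals, so that the infimum could a priori be
  negative.\<close>

lemma integrable_lborel_translate:
  fixes f :: "'a::euclidean_space \<Rightarrow> 'b::{banach, second_countable_topology}"
  assumes "integrable lborel f"
  shows "integrable lborel (\<lambda>z. f (z + a))"
proof -
  have "integrable (distr lborel borel ((+) a)) f"
    using assms by (simp add: lborel_distr_plus)
  then show ?thesis
    by (subst (asm) integrable_distr_eq) (use assms in \<open>auto simp: add.commute\<close>)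
qed

lemma integral_lborel_translate:
  fixes f :: "'a::euclidean_space \<Rightarrow> 'b::{banach, second_countable_topology}"
  assumes "f \<in> borel_measurable borel"
  shows "(\<integral>z. f (z + a) \<partial>lborel) = (\<integral>z. f z \<partial>lborel)"
proof -
  have "(\<integral>z. f z \<partial>lborel) = integral\<^sup>L (distr lborel borel ((+) a)) f"
    by (simp add: lborel_distr_plus)
  also have "\<dots> = (\<integral>z. f (z + a) \<partial>lborel)"
    by (subst integral_distr) (use assms in \<open>auto simp: add.commute\<close>)
  finally show ?thesis ..
qed

text \<open>Pointwise convergence may fail on the boundary of \<open>U\<close>. The positive part of
  i(z) - i(z + \<tau>) avoids this: it is dominated by the indicator and vanishes eventually because
  \<open>U\<close> is open. By translation invariance the negative part has the same integral,
  whence the factor 2.\<close>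

lemma L1_translate_tendsto_open:
  fixes U :: "'a::euclidean_space set" and \<tau> :: "nat \<Rightarrow> 'a"
  assumes U: "open U" "emeasure lborel U < \<infinity>" and \<tau>: "\<tau> \<longlonglongrightarrow> 0"
  shows "(\<lambda>n. \<integral>z. \<bar>indicator U (z + \<tau> n) - indicat_real U z\<bar> \<partial>lborel) \<longlonglongrightarrow> 0"
proof -
  define i where "i = indicat_real U"
  have [measurable]: "U \<in> sets borel" using U by simp
  have i: "integrable lborel i" unfolding i_def using U by simp
  have it: "integrable lborel (\<lambda>z. i (z + a))" for a
    by (rule integrable_lborel_translate[OF i])
  have [measurable]: "i \<in> borel_measurable borel" unfolding i_def by simp
  have "(\<integral>z. \<bar>i (z + \<tau> n) - i z\<bar> \<partial>lborel) = 2 * (\<integral>z. max 0 (i z - i (z + \<tau> n)) \<partial>lborel)" for n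
  proof -
    have "(\<integral>z. \<bar>i (z + \<tau> n) - i z\<bar> \<partial>lborel)
       = (\<integral>z. (2 * max 0 (i z - i (z + \<tau> n)) + i (z + \<tau> n)) - i z \<partial>lborel)"
      by (rule Bochner_Integration.integral_cong) (auto simp: max_def)
    also have "\<dots> = 2 * (\<integral>z. max 0 (i z - i (z + \<tau> n)) \<partial>lborel)"
      using i it by (simp add: integral_lborel_translate)
    finally show ?thesis .
  qed
  moreover have "(\<lambda>n. \<integral>z. max 0 (i z - i (z + \<tau> n)) \<partial>lborel) \<longlonglongrightarrow> (\<integral>z. 0 \<partial>(lborel::'a measure))"
  proof (rule integral_dominated_convergence[where w = i])
    show "AE z in lborel. (\<lambda>n. max 0 (i z - i (z + \<tau> n))) \<longlonglongrightarrow> 0"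
    proof (intro AE_I2)
      fix z
      show "(\<lambda>n. max 0 (i z - i (z + \<tau> n))) \<longlonglongrightarrow> 0"
      proof (cases "z \<in> U")
        case True
        have "(\<lambda>n. z + \<tau> n) \<longlonglongrightarrow> z" using tendsto_add[OF tendsto_const \<tau>, of z] by simp
        then have "eventually (\<lambda>n. z + \<tau> n \<in> U) sequentially"
          using True U(1) topological_tendstoD by blast
        then have "eventually (\<lambda>n. max 0 (i z - i (z + \<tau> n)) = 0) sequentially"
          by eventually_elim (use True in \<open>simp add: i_def\<close>)
        then show ?thesis by (rule tendsto_eventually)
      qed (simp add: i_def)
    qed
    show "AE z in lborel. norm (max 0 (i z - i (z + \<tau> n))) \<le> i z" for n
      by (simp add: i_def indicator_def)
  qed (use i in auto)
  ultimately show ?thesis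
    using tendsto_mult_right_zero[of _ sequentially 2] by (simp add: i_def[symmetric])
qed

text \<open>Outer regularity gives an open superset with small excess, which reduces this to the
  open case. The excess enters twice, once translated, with the same measure.\<close>

lemma L1_translate_tendsto_indicator:
  fixes B :: "'a::euclidean_space set" and \<tau> :: "nat \<Rightarrow> 'a"
  assumes B: "B \<in> sets borel" "emeasure lborel B < \<infinity>" and \<tau>: "\<tau> \<longlonglongrightarrow> 0"
  shows "(\<lambda>n. \<integral>z. \<bar>indicator B (z + \<tau> n) - indicat_real B z\<bar> \<partial>lborel) \<longlonglongrightarrow> 0"
proof (rule LIMSEQ_I)
  fix e :: real assume e: "0 < e"
  obtain U where U: "open U" "B \<subseteq> U" "emeasure lborel (U - B) < ennreal (e/3)"
    using outer_regular_lborel[OF B(1), of "e/3"] e by auto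
  have [measurable]: "U \<in> sets borel" "B \<in> sets borel" using U B by auto
  have "emeasure lborel U \<le> emeasure lborel B + emeasure lborel (U - B)"
    using emeasure_subadditive[of B lborel "U - B"] U by (simp add: Un_absorb1)
  also have "\<dots> < \<infinity>" using B(2) U(3) by (simp add: less_top[symmetric])
      (metis ennreal_add_eq_top ennreal_less_top less_irrefl less_trans)
  finally have Ufin: "emeasure lborel U < \<infinity>" .
  have UBfin: "emeasure lborel (U - B) < \<infinity>" using U(3) by (simp add: less_le_trans)
  define m where "m = measure lborel (U - B)"
  have m: "m < e/3"
    using U(3) e unfolding m_def
    by (metis UBfin emeasure_eq_ennreal_measure ennreal_less_iff infinity_ennreal_def less_irrefl measure_nonneg)
  have iUB: "integrable lborel (indicat_real (U - B))" using UBfin by simp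
  have iU: "integrable lborel (indicat_real U)" using Ufin by simp
  have iB: "integrable lborel (indicat_real B)" using B by simp
  note it = integrable_lborel_translate[OF iUB] integrable_lborel_translate[OF iU]
    integrable_lborel_translate[OF iB]
  from LIMSEQ_D[OF L1_translate_tendsto_open[OF U(1) Ufin \<tau>], of "e/3"] e
  obtain N where N: "\<And>n. n \<ge> N \<Longrightarrow> (\<integral>z. \<bar>indicator U (z + \<tau> n) - indicat_real U z\<bar> \<partial>lborel) < e/3"
    by auto
  show "\<exists>N. \<forall>n\<ge>N. norm ((\<integral>z. \<bar>indicator B (z + \<tau> n) - indicat_real B z\<bar> \<partial>lborel) - 0) < e"
  proof (intro exI allI impI)
    fix n assume "n \<ge> N"
    have "(\<integral>z. \<bar>indicator B (z + \<tau> n) - indicat_real B z\<bar> \<partial>lborel)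
      \<le> (\<integral>z. (indicator (U - B) (z + \<tau> n) + indicat_real (U - B) z)
              + \<bar>indicator U (z + \<tau> n) - indicat_real U z\<bar> \<partial>lborel)"
    proof (rule integral_mono)
      show "\<bar>indicator B (z + \<tau> n) - indicat_real B z\<bar> \<le> indicator (U - B) (z + \<tau> n) + indicat_real (U - B) z
              + \<bar>indicator U (z + \<tau> n) - indicat_real U z\<bar>" for z
        using U(2) by (auto simp: indicator_def)
    qed (intro it iUB iU iB Bochner_Integration.integrable_add integrable_abs Bochner_Integration.integrable_diff)+
    also have "\<dots> = m + m + (\<integral>z. \<bar>indicator U (z + \<tau> n) - indicat_real U z\<bar> \<partial>lborel)"
      using it iUB iU iB integral_lborel_translate[of "indicat_real (U - B)" "\<tau> n"]
      by (simp add: m_def)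
    also have "\<dots> < e" using m N[OF \<open>n \<ge> N\<close>] by simp
    finally show "norm ((\<integral>z. \<bar>indicator B (z + \<tau> n) - indicat_real B z\<bar> \<partial>lborel) - 0) < e"
      by simp
  qed
qed

lemma L1_translate_tendsto:
  fixes f :: "'a::euclidean_space \<Rightarrow> 'b::{banach, second_countable_topology}" and \<tau> :: "nat \<Rightarrow> 'a"
  assumes "integrable lborel f" and \<tau>: "\<tau> \<longlonglongrightarrow> 0"
  shows "(\<lambda>n. \<integral>z. norm (f (z + \<tau> n) - f z) \<partial>lborel) \<longlonglongrightarrow> 0"
  using assms(1)
proof (induction rule: integrable_induct)
  case (base B c)
  have "norm (indicator B (z + \<tau> n) *\<^sub>R c - indicator B z *\<^sub>R c)
      = norm c * \<bar>indicator B (z + \<tau> n) - indicat_real B z\<bar>" for z n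
    by (simp add: scaleR_left_diff_distrib[symmetric] mult.commute)
  then show ?case
    using tendsto_mult_right_zero[OF L1_translate_tendsto_indicator[OF _ base(2) \<tau>], of "norm c"] base(1) by simp
next
  case (add f g)
  note i = add.hyps integrable_lborel_translate[OF add.hyps(1)] integrable_lborel_translate[OF add.hyps(2)]
  show ?case
  proof (rule tendsto_sandwich[OF _ _ tendsto_const tendsto_add_zero[OF add.IH]])
    show "\<forall>\<^sub>F n in sequentially. (\<integral>z. norm (f (z + \<tau> n) + g (z + \<tau> n) - (f z + g z)) \<partial>lborel)
       \<le> (\<integral>z. norm (f (z + \<tau> n) - f z) \<partial>lborel) + (\<integral>z. norm (g (z + \<tau> n) - g z) \<partial>lborel)"
    proof (intro always_eventually allI)
      fix n
      have "(\<integral>z. norm (f (z + \<tau> n) + g (z + \<tau> n) - (f z + g z)) \<partial>lborel)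
        \<le> (\<integral>z. norm (f (z + \<tau> n) - f z) + norm (g (z + \<tau> n) - g z) \<partial>lborel)"
        using i by (intro integral_mono) (auto intro: norm_diff_triangle_ineq)
      also have "\<dots> = (\<integral>z. norm (f (z + \<tau> n) - f z) \<partial>lborel) + (\<integral>z. norm (g (z + \<tau> n) - g z) \<partial>lborel)"
        using i by simp
      finally show "(\<integral>z. norm (f (z + \<tau> n) + g (z + \<tau> n) - (f z + g z)) \<partial>lborel) \<le> \<dots>" .
    qed
  qed auto
next
  case (lim f s)
  \<comment> \<open>The factor 3 comes from the bound |s k| <= 2 |f| for the approximating simple
    functions.\<close>
  have c: "(\<lambda>k. \<integral>z. norm (s k z - f z) \<partial>lborel) \<longlonglongrightarrow> (\<integral>z. 0 \<partial>(lborel::'a measure))"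
  proof (rule integral_dominated_convergence[where w = "\<lambda>z. 3 * norm (f z)"])
    show "AE z in lborel. (\<lambda>k. norm (s k z - f z)) \<longlonglongrightarrow> 0"
      using lim.hyps(2) by (auto intro!: tendsto_norm_zero simp: LIM_zero_iff)
    show "AE z in lborel. norm (norm (s k z - f z)) \<le> 3 * norm (f z)" for k
    proof (intro AE_I2)
      fix z :: 'a
      show "norm (norm (s k z - f z)) \<le> 3 * norm (f z)"
        using norm_triangle_ineq4[of "s k z" "f z"] lim.hyps(3)[of z k] by simp
    qed
  qed (use lim.hyps(1,4) in auto)
  show ?case
  proof (rule LIMSEQ_I)
    fix e :: real assume e: "0 < e"
    then obtain k where k: "(\<integral>z. norm (s k z - f z) \<partial>lborel) < e/3"
      using LIMSEQ_D[OF c, of "e/3"] by auto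
    obtain N where N: "\<And>n. n \<ge> N \<Longrightarrow> (\<integral>z. norm (s k (z + \<tau> n) - s k z) \<partial>lborel) < e/3"
      using LIMSEQ_D[OF lim.IH[of k], of "e/3"] e by auto
    note i = lim.hyps(1)[of k] lim.hyps(4) integrable_lborel_translate[OF lim.hyps(1)[of k]] integrable_lborel_translate[OF lim.hyps(4)]
    have [measurable]: "s k \<in> borel_measurable borel" "f \<in> borel_measurable borel" using i by auto
    show "\<exists>N. \<forall>n\<ge>N. norm ((\<integral>z. norm (f (z + \<tau> n) - f z) \<partial>lborel) - 0) < e"
    proof (intro exI allI impI)
      fix n assume n: "n \<ge> N"
      have "(\<integral>z. norm (f (z + \<tau> n) - f z) \<partial>lborel)
         \<le> (\<integral>z. norm (s k (z + \<tau> n) - f (z + \<tau> n)) + norm (s k z - f z)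
              + norm (s k (z + \<tau> n) - s k z) \<partial>lborel)"
        using i
      proof (intro integral_mono)
        fix z
        have "f (z + \<tau> n) - f z = - (s k (z + \<tau> n) - f (z + \<tau> n)) + (s k z - f z) + (s k (z + \<tau> n) - s k z)"
          by simp
        then show "norm (f (z + \<tau> n) - f z) \<le> norm (s k (z + \<tau> n) - f (z + \<tau> n)) + norm (s k z - f z)
              + norm (s k (z + \<tau> n) - s k z)"
          by (metis norm_minus_cancel norm_triangle_mono order_refl norm_triangle_ineq)
      qed auto
      also have "\<dots> = (\<integral>z. norm (s k z - f z) \<partial>lborel) + (\<integral>z. norm (s k z - f z) \<partial>lborel)
             + (\<integral>z. norm (s k (z + \<tau> n) - s k z) \<partial>lborel)"
        using i integral_lborel_translate[of "\<lambda>z. norm (s k z - f z)" "\<tau> n"] by simp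
      also have "\<dots> < e" using k N[OF n] by simp
      finally show "norm ((\<integral>z. norm (f (z + \<tau> n) - f z) \<partial>lborel) - 0) < e" by simp
    qed
  qed
qed

text \<open>Applied to \<open>f\<close> and its translate, this deduces continuity of translations in \<open>L\<^sup>2\<close> from
  continuity in \<open>L\<^sup>1\<close> of the translations of \<open>|f| f\<close>.\<close>

lemma norm_diff_square_le:
  fixes a b :: "'a::real_inner"
  shows "(norm (a - b))\<^sup>2 \<le> 2 * norm (norm a *\<^sub>R a - norm b *\<^sub>R b)"
proof (cases "a = b")
  case False
  define d where "d = norm (a - b)"
  have d: "d > 0" using False by (simp add: d_def)
  have d2: "d\<^sup>2 = (norm a)\<^sup>2 + (norm b)\<^sup>2 - 2 * (a \<bullet> b)"
    unfolding d_def power2_norm_eq_inner by (simp add: inner_diff inner_commute)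
  \<comment> \<open>The added square completes the left side to exactly twice the inner product of
    |a| a - |b| b with a - b.\<close>
  have "(norm a + norm b) * d\<^sup>2 \<le> (norm a + norm b) * (d\<^sup>2 + (norm a - norm b)\<^sup>2)"
    by (intro mult_left_mono) auto
  also have "\<dots> = 2 * ((norm a *\<^sub>R a - norm b *\<^sub>R b) \<bullet> (a - b))"
    unfolding d2 inner_diff inner_scaleR_left dot_square_norm
    by (simp add: inner_commute power2_eq_square algebra_simps dot_square_norm)
  also have "\<dots> \<le> 2 * (norm (norm a *\<^sub>R a - norm b *\<^sub>R b) * d)"
    using norm_cauchy_schwarz[of "norm a *\<^sub>R a - norm b *\<^sub>R b" "a - b"] by (simp add: d_def)
  finally have "((norm a + norm b) * d) * d \<le> (2 * norm (norm a *\<^sub>R a - norm b *\<^sub>R b)) * d"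
    by (simp add: power2_eq_square algebra_simps)
  then have "(norm a + norm b) * d \<le> 2 * norm (norm a *\<^sub>R a - norm b *\<^sub>R b)"
    using d by simp
  moreover have "d * d \<le> (norm a + norm b) * d"
    using d norm_triangle_ineq4[of a b] by (intro mult_right_mono) (auto simp: d_def)
  ultimately show ?thesis by (simp add: d_def power2_eq_square)
qed simp

text \<open>Functions on \<open>D\<close> or on a space-time cylinder enter multiplied by an
  indicator, so that they live on the whole space and can be translated freely.\<close>

definition sq_integrable :: "'a measure \<Rightarrow> ('a \<Rightarrow> 'b::euclidean_space) \<Rightarrow> bool" where
  "sq_integrable M f \<longleftrightarrow> f \<in> borel_measurable M \<and> integrable M (\<lambda>x. (norm (f x))\<^sup>2)"

lemma sq_integrable_measurable [measurable_dest]: "sq_integrable M f \<Longrightarrow> f \<in> borel_measurable M"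
  by (simp add: sq_integrable_def)

lemma sq_integrable_bound:
  assumes "sq_integrable M f" "g \<in> borel_measurable M" "AE x in M. norm (g x) \<le> C * norm (f x)"
  shows "sq_integrable M g"
proof -
  have "integrable M (\<lambda>x. C\<^sup>2 * (norm (f x))\<^sup>2)" using assms(1) by (simp add: sq_integrable_def)
  then have "integrable M (\<lambda>x. (norm (g x))\<^sup>2)"
  proof (rule Bochner_Integration.integrable_bound)
    show "AE x in M. norm ((norm (g x))\<^sup>2) \<le> norm (C\<^sup>2 * (norm (f x))\<^sup>2)"
      using assms(3)
    proof eventually_elim
      case (elim x)
      then show ?case using power_mono[OF elim, of 2] by (simp add: power_mult_distrib)
    qed
  qed (use assms(2) in measurable)
  then show ?thesis using assms(2) by (simp add: sq_integrable_def)
qed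

lemma sq_integrable_add:
  assumes "sq_integrable M f" "sq_integrable M g"
  shows "sq_integrable M (\<lambda>x. f x + g x)"
proof -
  have [measurable]: "f \<in> borel_measurable M" "g \<in> borel_measurable M"
    using assms by (auto simp: sq_integrable_def)
  have "integrable M (\<lambda>x. 2 * (norm (f x))\<^sup>2 + 2 * (norm (g x))\<^sup>2)"
    using assms by (simp add: sq_integrable_def)
  then have "integrable M (\<lambda>x. (norm (f x + g x))\<^sup>2)"
  proof (rule Bochner_Integration.integrable_bound)
    have "(norm (f x + g x))\<^sup>2 \<le> 2 * (norm (f x))\<^sup>2 + 2 * (norm (g x))\<^sup>2" for x
    proof -
      have "(norm (f x + g x))\<^sup>2 \<le> (norm (f x) + norm (g x))\<^sup>2"
        by (intro power_mono norm_triangle_ineq) auto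
      also have "\<dots> \<le> 2 * (norm (f x))\<^sup>2 + 2 * (norm (g x))\<^sup>2"
        using zero_le_power2[of "norm (f x) - norm (g x)"] by (simp add: power2_eq_square algebra_simps)
      finally show ?thesis .
    qed
    then show "AE x in M. norm ((norm (f x + g x))\<^sup>2) \<le> norm (2 * (norm (f x))\<^sup>2 + 2 * (norm (g x))\<^sup>2)"
      by (auto intro!: AE_I2 order_trans[OF _ abs_ge_self])
  qed measurable
  then show ?thesis by (simp add: sq_integrable_def)
qed

lemma sq_integrable_minus: "sq_integrable M f \<Longrightarrow> sq_integrable M (\<lambda>x. - f x)"
  by (simp add: sq_integrable_def)

lemma sq_integrable_diff:
  "sq_integrable M f \<Longrightarrow> sq_integrable M g \<Longrightarrow> sq_integrable M (\<lambda>x. f x - g x)"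
  using sq_integrable_add[of M f "\<lambda>x. - g x"] sq_integrable_minus by auto

lemma integrable_inner_sq:
  assumes "sq_integrable M f" "sq_integrable M g"
  shows "integrable M (\<lambda>x. f x \<bullet> g x)"
proof -
  have [measurable]: "f \<in> borel_measurable M" "g \<in> borel_measurable M"
    using assms by (auto simp: sq_integrable_def)
  have "integrable M (\<lambda>x. (norm (f x))\<^sup>2 + (norm (g x))\<^sup>2)"
    using assms by (simp add: sq_integrable_def)
  then show ?thesis
  proof (rule Bochner_Integration.integrable_bound)
    have "\<bar>f x \<bullet> g x\<bar> \<le> (norm (f x))\<^sup>2 + (norm (g x))\<^sup>2" for x
    proof -
      have "\<bar>f x \<bullet> g x\<bar> \<le> norm (f x) * norm (g x)" by (rule Cauchy_Schwarz_ineq2)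
      also have "\<dots> \<le> (norm (f x))\<^sup>2 + (norm (g x))\<^sup>2"
        using sum_squares_bound[of "norm (f x)" "norm (g x)"]
          mult_nonneg_nonneg[OF norm_ge_zero[of "f x"] norm_ge_zero[of "g x"]]
        by linarith
      finally show ?thesis .
    qed
    then show "AE x in M. norm (f x \<bullet> g x) \<le> norm ((norm (f x))\<^sup>2 + (norm (g x))\<^sup>2)"
      by (auto intro!: AE_I2 order_trans[OF _ abs_ge_self])
  qed measurable
qed

text \<open>Stated for a general filter: it is applied along approximating sequences and along times
  tending to a given time. A weighted Young inequality stands in for Cauchy-Schwarz for
  integrals.\<close>

lemma tendsto_integral_inner:
  assumes f: "\<forall>\<^sub>F i in F. sq_integrable M (f i)" "sq_integrable M f'" and g: "sq_integrable M g"
    and lim: "((\<lambda>i. \<integral>x. (norm (f i x - f' x))\<^sup>2 \<partial>M) \<longlongrightarrow> 0) F"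
  shows "((\<lambda>i. \<integral>x. f i x \<bullet> g x \<partial>M) \<longlongrightarrow> (\<integral>x. f' x \<bullet> g x \<partial>M)) F"
proof (rule tendstoI)
  fix e :: real assume e: "e > 0"
  define G where "G = (\<integral>x. (norm (g x))\<^sup>2 \<partial>M)"
  have G0: "G \<ge> 0" by (simp add: G_def)
  \<comment> \<open>With this weight each half of Young's bound stays below e/2; the added 1 covers
    the case G = 0.\<close>
  define \<eta> where "\<eta> = e / (G + 1)"
  have eta: "\<eta> > 0" "\<eta> * G < e" using e G0 by (auto simp: \<eta>_def field_simps)
  have "\<forall>\<^sub>F i in F. (\<integral>x. (norm (f i x - f' x))\<^sup>2 \<partial>M) < e * \<eta>"
    using order_tendstoD(2)[OF lim, of "e * \<eta>"] e eta by simp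
  with f(1) show "\<forall>\<^sub>F i in F. dist (\<integral>x. f i x \<bullet> g x \<partial>M) (\<integral>x. f' x \<bullet> g x \<partial>M) < e"
  proof eventually_elim
    case (elim i)
    note d = sq_integrable_diff[OF elim(1) f(2)]
    have int: "integrable M (\<lambda>x. (norm (f i x - f' x))\<^sup>2)" "integrable M (\<lambda>x. (norm (g x))\<^sup>2)"
      using d g by (auto simp: sq_integrable_def)
    have "\<bar>(f i x - f' x) \<bullet> g x\<bar> \<le> (1 / (2 * \<eta>)) * (norm (f i x - f' x))\<^sup>2 + (\<eta> / 2) * (norm (g x))\<^sup>2" for x
    proof -
      have "\<bar>(f i x - f' x) \<bullet> g x\<bar> \<le> norm (f i x - f' x) * norm (g x)" by (rule Cauchy_Schwarz_ineq2)
      also have "\<dots> \<le> (1 / (2 * \<eta>)) * (norm (f i x - f' x))\<^sup>2 + (\<eta> / 2) * (norm (g x))\<^sup>2"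
        using zero_le_power2[of "norm (f i x - f' x) - \<eta> * norm (g x)"] eta(1)
        by (simp add: field_simps power2_eq_square)
      finally show ?thesis .
    qed
    note pt = this
    have "dist (\<integral>x. f i x \<bullet> g x \<partial>M) (\<integral>x. f' x \<bullet> g x \<partial>M) = \<bar>\<integral>x. (f i x - f' x) \<bullet> g x \<partial>M\<bar>"
      using integrable_inner_sq[OF elim(1) g] integrable_inner_sq[OF f(2) g]
      by (simp add: dist_real_def inner_diff_left)
    also have "\<dots> \<le> (\<integral>x. \<bar>(f i x - f' x) \<bullet> g x\<bar> \<partial>M)" by (rule integral_abs_bound)
    also have "\<dots> \<le> (\<integral>x. (1 / (2 * \<eta>)) * (norm (f i x - f' x))\<^sup>2 + (\<eta> / 2) * (norm (g x))\<^sup>2 \<partial>M)"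
      using pt int integrable_inner_sq[OF d g] by (intro integral_mono) auto
    also have "\<dots> = (1 / (2 * \<eta>)) * (\<integral>x. (norm (f i x - f' x))\<^sup>2 \<partial>M) + (\<eta> / 2) * G"
      using int by (simp add: G_def)
    also have "\<dots> < (1 / (2 * \<eta>)) * (e * \<eta>) + e / 2"
      using elim(2) eta by (intro add_strict_mono mult_strict_left_mono) auto
    also have "\<dots> = e" using eta by simp
    finally show ?case .
  qed
qed

section \<open>Translations in L^2\<close>

lemma sq_integrable_translate:
  fixes f :: "'a::euclidean_space \<Rightarrow> 'b::euclidean_space"
  assumes "sq_integrable lborel f"
  shows "sq_integrable lborel (\<lambda>z. f (z + a))"
proof -
  have [measurable]: "f \<in> borel_measurable borel" using assms by (simp add: sq_integrable_def)
  show ?thesis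
    using assms integrable_lborel_translate[of "\<lambda>z. (norm (f z))\<^sup>2" a] by (simp add: sq_integrable_def)
qed

lemma tendsto_inner_translate:
  fixes f g :: "'a::euclidean_space \<Rightarrow> 'b::euclidean_space"
  assumes f: "sq_integrable lborel f" and g: "sq_integrable lborel g" and \<tau>: "\<tau> \<longlonglongrightarrow> 0"
  shows "(\<lambda>n. \<integral>z. f (z + \<tau> n) \<bullet> g z \<partial>lborel) \<longlonglongrightarrow> (\<integral>z. f z \<bullet> g z \<partial>lborel)"
proof (rule tendsto_integral_inner[OF always_eventually f g])
  show "\<forall>n. sq_integrable lborel (\<lambda>z. f (z + \<tau> n))"
    by (intro allI sq_integrable_translate f)
  have [measurable]: "f \<in> borel_measurable borel" using f by (simp add: sq_integrable_def)
  have i: "integrable lborel (\<lambda>z. norm (f z) *\<^sub>R f z)"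
    using f by (intro integrable_norm_cancel[of _ "\<lambda>z. norm (f z) *\<^sub>R f z"])
      (auto simp: sq_integrable_def power2_eq_square)
  have it: "integrable lborel (\<lambda>z. norm (f (z + a)) *\<^sub>R f (z + a))" for a
    by (rule integrable_lborel_translate[OF i])
  show "(\<lambda>n. \<integral>z. (norm (f (z + \<tau> n) - f z))\<^sup>2 \<partial>lborel) \<longlonglongrightarrow> 0"
  proof (rule tendsto_sandwich[OF _ _ tendsto_const tendsto_mult_right_zero[OF L1_translate_tendsto[OF i \<tau>]]])
    show "\<forall>\<^sub>F n in sequentially. (\<integral>z. (norm (f (z + \<tau> n) - f z))\<^sup>2 \<partial>lborel)
        \<le> 2 * (\<integral>z. norm (norm (f (z + \<tau> n)) *\<^sub>R f (z + \<tau> n) - norm (f z) *\<^sub>R f z) \<partial>lborel)"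
    proof (intro always_eventually allI)
      fix n
      have "(\<integral>z. (norm (f (z + \<tau> n) - f z))\<^sup>2 \<partial>lborel)
        \<le> (\<integral>z. 2 * norm (norm (f (z + \<tau> n)) *\<^sub>R f (z + \<tau> n) - norm (f z) *\<^sub>R f z) \<partial>lborel)"
        using sq_integrable_diff[OF sq_integrable_translate[OF f, of "\<tau> n"] f] i it
        by (intro integral_mono norm_diff_square_le) (auto simp: sq_integrable_def)
      then show "(\<integral>z. (norm (f (z + \<tau> n) - f z))\<^sup>2 \<partial>lborel)
        \<le> 2 * (\<integral>z. norm (norm (f (z + \<tau> n)) *\<^sub>R f (z + \<tau> n) - norm (f z) *\<^sub>R f z) \<partial>lborel)"
        by simp
    qed
  qed auto
qed

section \<open>The energy inequality for weak solutions\<close>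

lemma QM_eq_lborel: "QM = lborel"
  unfolding QM_def by (rule lborel_prod)

lemma
  fixes q :: "'a::euclidean_space \<Rightarrow> real"
  assumes q: "integrable lborel q" and I: "I \<in> sets borel" "emeasure lborel I < \<infinity>"
  shows integrable_times_indicator_snd:
      "integrable lborel (\<lambda>z::'a \<times> real. q (fst z) * indicator I (snd z))"
    and integral_times_indicator_snd:
      "(\<integral>z. q (fst z) * indicator I (snd z) \<partial>(lborel :: ('a \<times> real) measure)) = (\<integral>x. q x \<partial>lborel) * measure lborel I"
proof -
  have [measurable]: "q \<in> borel_measurable borel" "I \<in> sets borel" using q I by auto
  have i: "integrable (lborel \<Otimes>\<^sub>M lborel) (\<lambda>z::'a \<times> real. q (fst z) * indicator I (snd z))"
  proof (rule lborel_pair.Fubini_integrable)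
    show "integrable lborel (\<lambda>x. \<integral>y. norm (q (fst (x, y)) * indicator I (snd (x, y::real))) \<partial>lborel)"
      using q by (simp add: abs_mult)
    show "AE x in lborel. integrable lborel (\<lambda>y. q (fst (x, y)) * indicator I (snd (x, y::real)))"
      using I by simp
  qed measurable
  then show "integrable lborel (\<lambda>z::'a \<times> real. q (fst z) * indicator I (snd z))"
    by (simp add: lborel_prod)
  show "(\<integral>z. q (fst z) * indicator I (snd z) \<partial>(lborel :: ('a \<times> real) measure)) = (\<integral>x. q x \<partial>lborel) * measure lborel I"
    using lborel_pair.integral_fst'[OF i] by (simp add: lborel_prod)
qed

section \<open>Test functions and their gradients in L^2\<close>

lemma grad_continuous: "smooth_fun \<psi> \<Longrightarrow> continuous_on UNIV (grad \<psi>)"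
  unfolding grad_def[abs_def] smooth_fun_def by (intro continuous_on_vec_lambda) blast

text \<open>The complement of the compact set is open, so near each of its points the function
  vanishes along every axis; the gradient therefore has the same support set.\<close>

lemma testfun_support:
  assumes "testfun D \<psi>"
  obtains C where "compact C" "C \<subseteq> D" "\<And>x. x \<notin> C \<Longrightarrow> \<psi> x = 0" "\<And>x. x \<notin> C \<Longrightarrow> grad \<psi> x = 0"
proof -
  obtain C where C: "compact C" "C \<subseteq> D" "\<And>x. x \<notin> C \<Longrightarrow> \<psi> x = 0"
    using assms unfolding testfun_def by blast
  have "grad \<psi> x = 0" if x: "x \<notin> C" for x
  proof -
    have "deriv (\<lambda>s. \<psi> (x + s *\<^sub>R axis i 1)) 0 = 0" for i
    proof -
      have "open (- C)" using C(1) compact_imp_closed by blast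
      moreover have "((\<lambda>s. x + s *\<^sub>R axis i (1::real)) \<longlongrightarrow> x + 0 *\<^sub>R axis i 1) (nhds 0)"
        by (intro tendsto_intros filterlim_ident)
      ultimately have "\<forall>\<^sub>F s in nhds 0. x + s *\<^sub>R axis i (1::real) \<in> - C"
        using x topological_tendstoD[of _ "x + 0 *\<^sub>R axis i (1::real)" "nhds 0" "- C"] by simp
      then have "\<forall>\<^sub>F s in nhds 0. \<psi> (x + s *\<^sub>R axis i 1) = 0"
        by eventually_elim (use C(3) in auto)
      then have "deriv (\<lambda>s. \<psi> (x + s *\<^sub>R axis i 1)) 0 = deriv (\<lambda>s. 0) 0"
        by (intro deriv_cong_ev) auto
      then show ?thesis by simp
    qed
    then show ?thesis by (simp add: grad_def vec_eq_iff)
  qed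
  with C that show thesis by blast
qed

lemma sq_integrable_continuous_compact_support:
  fixes f :: "'a::euclidean_space \<Rightarrow> 'b::euclidean_space"
  assumes f: "continuous_on UNIV f" and C: "compact C" "\<And>x. x \<notin> C \<Longrightarrow> f x = 0"
  shows "sq_integrable lborel f"
proof -
  have "integrable lborel (\<lambda>x. indicator C x *\<^sub>R (norm (f x))\<^sup>2)"
    by (intro borel_integrable_compact C continuous_intros continuous_on_subset[OF f]) auto
  also have "(\<lambda>x. indicator C x *\<^sub>R (norm (f x))\<^sup>2) = (\<lambda>x. (norm (f x))\<^sup>2)"
    using C(2) by (auto simp: indicator_def fun_eq_iff)
  finally show ?thesis
    using borel_measurable_continuous_onI[OF f] by (simp add: sq_integrable_def)
qed

lemma testfun_sq_integrable:
  assumes "testfun D \<psi>"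
  shows "sq_integrable lborel \<psi>" "sq_integrable lborel (grad \<psi>)"
proof -
  obtain C where C: "compact C" "C \<subseteq> D" "\<And>x. x \<notin> C \<Longrightarrow> \<psi> x = 0" "\<And>x. x \<notin> C \<Longrightarrow> grad \<psi> x = 0"
    using testfun_support[OF assms] by blast
  have s: "smooth_fun \<psi>" using assms by (simp add: testfun_def)
  have "continuous_on UNIV (pd [] \<psi>)" using s unfolding smooth_fun_def by blast
  then show "sq_integrable lborel \<psi>"
    using C by (intro sq_integrable_continuous_compact_support[of \<psi> C]) auto
  show "sq_integrable lborel (grad \<psi>)"
    using C s by (intro sq_integrable_continuous_compact_support[of _ C] grad_continuous) auto
qed

lemma sq_integrable_indicator:
  assumes "sq_integrable M f" "S \<in> sets M"
  shows "sq_integrable M (\<lambda>x. indicator S x *\<^sub>R f x)"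
proof -
  have [measurable]: "f \<in> borel_measurable M" "S \<in> sets M" using assms by (auto simp: sq_integrable_def)
  show ?thesis
    by (rule sq_integrable_bound[OF assms(1), where C = 1]) (auto simp: indicator_def)
qed

lemma sq_integrable_indicator_iff:
  assumes [measurable]: "f \<in> borel_measurable M" "S \<in> sets M"
  shows "sq_integrable M (\<lambda>x. indicator S x *\<^sub>R f x) \<longleftrightarrow> set_integrable M S (\<lambda>x. (norm (f x))\<^sup>2)"
proof -
  have "(\<lambda>x. (norm (indicat_real S x *\<^sub>R f x))\<^sup>2) = (\<lambda>x. indicat_real S x *\<^sub>R (norm (f x))\<^sup>2)"
    by (auto simp: indicator_def fun_eq_iff)
  then show ?thesis by (simp add: sq_integrable_def set_integrable_def)
qed

lemma norm_snd_le': "norm (snd z) \<le> norm z"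
  by (metis norm_snd_le prod.collapse)

lemma sq_integrable_Pair:
  assumes "sq_integrable M f" "sq_integrable M g"
  shows "sq_integrable M (\<lambda>x. (f x, g x))"
proof -
  have [measurable]: "f \<in> borel_measurable M" "g \<in> borel_measurable M"
    using assms by (auto simp: sq_integrable_def)
  have "(norm (f x, g x))\<^sup>2 = (norm (f x))\<^sup>2 + (norm (g x))\<^sup>2" for x
    by (simp add: norm_Pair)
  then show ?thesis
    using assms by (auto simp: sq_integrable_def intro!: borel_measurable_Pair)
qed

text \<open>A nonzero function of \<open>x\<close> alone is not square integrable over space-time;
  cutting it off in time makes its pairing with \<open>A\<close> legitimate.\<close>

lemma sq_integrable_fst_indicator:
  fixes f :: "'a::euclidean_space \<Rightarrow> 'b::euclidean_space"
  assumes "sq_integrable lborel f" "I \<in> sets borel" "emeasure lborel I < \<infinity>"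
  shows "sq_integrable lborel (\<lambda>z::'a \<times> real. indicator I (snd z) *\<^sub>R f (fst z))"
proof -
  have [measurable]: "f \<in> borel_measurable borel" "I \<in> sets borel"
    using assms by (auto simp: sq_integrable_def)
  have "integrable lborel (\<lambda>z::'a \<times> real. (norm (f (fst z)))\<^sup>2 * indicator I (snd z))"
    using assms by (intro integrable_times_indicator_snd[where q = "\<lambda>x. (norm (f x))\<^sup>2"]) (auto simp: sq_integrable_def)
  also have "(\<lambda>z::'a \<times> real. (norm (f (fst z)))\<^sup>2 * indicator I (snd z))
      = (\<lambda>z. (norm (indicator I (snd z) *\<^sub>R f (fst z)))\<^sup>2)"
    by (auto simp: indicator_def fun_eq_iff)
  finally have *: "integrable lborel (\<lambda>z::'a \<times> real. (norm (indicator I (snd z) *\<^sub>R f (fst z)))\<^sup>2)" .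
  have "(\<lambda>z::'a \<times> real. indicator I (snd z) *\<^sub>R f (fst z)) \<in> borel_measurable (borel \<Otimes>\<^sub>M borel)"
    by measurable
  with * show ?thesis by (simp add: sq_integrable_def borel_prod)
qed

text \<open>An abstract form of the weak equation \<open>u' = - div A\<^sub>1 + A\<^sub>2\<close>, \<open>u(0) = 0\<close> on \<open>D \<times> (0, t)\<close>. The initial
  condition is used by extending \<open>u\<close> and \<open>A\<close> by zero to negative times, which preserves the
  equation.\<close>

locale weak_evolution =
  fixes D :: "(real^'n::finite) set" and t :: real
    and u :: "real^'n \<Rightarrow> real \<Rightarrow> real" and Du :: "real^'n \<Rightarrow> real \<Rightarrow> real^'n"
    and A :: "(real^'n) \<times> real \<Rightarrow> (real^'n) \<times> real"
  assumes t: "0 < t" and D: "open D"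
    and u_meas: "(\<lambda>z. u (fst z) (snd z)) \<in> borel_measurable borel"
    and Du_meas: "(\<lambda>z. Du (fst z) (snd z)) \<in> borel_measurable borel"
    and W_sq: "sq_integrable lborel
      (\<lambda>z. indicator (D \<times> {0<..<t}) z *\<^sub>R (Du (fst z) (snd z), u (fst z) (snd z)))"
    and A_sq: "sq_integrable lborel A"
    and A_zero: "\<And>z. z \<notin> D \<times> {0<..<t} \<Longrightarrow> A z = 0"
    and H1: "AE s in lborel. s \<in> {0<..<t} \<longrightarrow> H10 D (\<lambda>x. u x s) (\<lambda>x. Du x s)"
    and u_sq: "\<And>s. s \<in> {0..t} \<Longrightarrow> set_integrable lborel D (\<lambda>x. (u x s)\<^sup>2)"
    and u_cont: "\<And>s. s \<in> {0..t} \<Longrightarrow>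
      ((\<lambda>r. LINT x:D|lborel. (u x r - u x s)\<^sup>2) \<longlongrightarrow> 0) (at s within {0..t})"
    and weak: "\<And>s \<psi>. s \<in> {0..t} \<Longrightarrow> testfun D \<psi> \<Longrightarrow>
      (LINT x:D|lborel. u x s * \<psi> x)
      = (\<integral>z. indicator {..<s} (snd z) * (A z \<bullet> (grad \<psi> (fst z), \<psi> (fst z))) \<partial>lborel)"
begin

section \<open>The weak equation for H^1 test functions\<close>

lemma D_sets [measurable]: "D \<in> sets borel" using D by simp

lemma u_slice [measurable]: "(\<lambda>x. u x s) \<in> borel_measurable borel"
  and Du_slice [measurable]: "(\<lambda>x. Du x s) \<in> borel_measurable borel"
proof -
  have "(\<lambda>x. (x, s)) \<in> borel_measurable borel"
    by (intro borel_measurable_continuous_onI continuous_intros)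
  from measurable_compose[OF this u_meas] measurable_compose[OF this Du_meas]
  show "(\<lambda>x. u x s) \<in> borel_measurable borel" "(\<lambda>x. Du x s) \<in> borel_measurable borel" by simp_all
qed

lemma u_slice_sq: "s \<in> {0..t} \<Longrightarrow> sq_integrable lborel (\<lambda>x. indicator D x *\<^sub>R u x s)"
  using u_sq[of s] by (subst sq_integrable_indicator_iff) auto

text \<open>Both sides are continuous in the L^2 norms of the test function and its gradient, and
  \<open>H10\<close> provides approximation by test functions in these norms. This is what allows
  testing with a slice of \<open>u\<close>.\<close>

lemma weak_H10:
  assumes s: "s \<in> {0..t}" and v: "v \<in> borel_measurable borel" and w: "w \<in> borel_measurable borel"
    and H: "H10 D v w"
  shows "(LINT x:D|lborel. u x s * v x)
      = (\<integral>z. indicator {..<s} (snd z) * (A z \<bullet> (indicator D (fst z) *\<^sub>R (w (fst z), v (fst z)))) \<partial>lborel)"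
proof -
  note [measurable] = v w
  obtain \<phi> where \<phi>: "\<And>k. testfun D (\<phi> k)"
    and l1: "(\<lambda>k. LINT x:D|lborel. (\<phi> k x - v x)\<^sup>2) \<longlonglongrightarrow> 0"
    and l2: "(\<lambda>k. LINT x:D|lborel. (norm (grad (\<phi> k) x - w x))\<^sup>2) \<longlonglongrightarrow> 0"
    using H unfolding H10_def by blast
  have v_sq: "sq_integrable lborel (\<lambda>x. indicator D x *\<^sub>R v x)"
    and w_sq: "sq_integrable lborel (\<lambda>x. indicator D x *\<^sub>R w x)"
    using H unfolding H10_def by (subst sq_integrable_indicator_iff; simp)+
  have \<phi>_sq: "sq_integrable lborel (\<lambda>x. indicator D x *\<^sub>R \<phi> k x)"
    and g_sq: "sq_integrable lborel (\<lambda>x. indicator D x *\<^sub>R grad (\<phi> k) x)" for k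
    using testfun_sq_integrable[OF \<phi>[of k]] by (intro sq_integrable_indicator; simp)+
  have "(\<lambda>k. \<integral>x. (indicator D x *\<^sub>R \<phi> k x) \<bullet> (indicator D x *\<^sub>R u x s) \<partial>lborel)
      \<longlonglongrightarrow> (\<integral>x. (indicator D x *\<^sub>R v x) \<bullet> (indicator D x *\<^sub>R u x s) \<partial>lborel)"
  proof (rule tendsto_integral_inner[OF always_eventually v_sq u_slice_sq[OF s]])
    have "(\<integral>x. (norm (indicator D x *\<^sub>R \<phi> k x - indicator D x *\<^sub>R v x))\<^sup>2 \<partial>lborel)
        = (LINT x:D|lborel. (\<phi> k x - v x)\<^sup>2)" for k
      unfolding set_lebesgue_integral_def
      by (intro Bochner_Integration.integral_cong) (auto simp: indicator_def)
    with l1 show "(\<lambda>k. \<integral>x. (norm (indicator D x *\<^sub>R \<phi> k x - indicator D x *\<^sub>R v x))\<^sup>2 \<partial>lborel) \<longlonglongrightarrow> 0"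
      by simp
  qed (use \<phi>_sq in auto)
  moreover have "(\<integral>x. (indicator D x *\<^sub>R y x) \<bullet> (indicator D x *\<^sub>R u x s) \<partial>lborel) = (LINT x:D|lborel. u x s * y x)" for y
    unfolding set_lebesgue_integral_def
    by (intro Bochner_Integration.integral_cong) (auto simp: indicator_def)
  ultimately have L: "(\<lambda>k. LINT x:D|lborel. u x s * \<phi> k x) \<longlonglongrightarrow> (LINT x:D|lborel. u x s * v x)" by simp
  \<comment> \<open>The test pair is cut off to the time interval on which \<open>A\<close> lives:
    the pairing does not change, and the pair becomes square integrable over space-time.\<close>
  define P where "P = (\<lambda>(v::real^'n \<Rightarrow> real) (w::real^'n \<Rightarrow> real^'n) (z::(real^'n)\<times>real).
    indicator {0<..<t} (snd z) *\<^sub>R (indicator D (fst z) *\<^sub>R w (fst z), indicator D (fst z) *\<^sub>R v (fst z)))"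
  have P_sq: "sq_integrable lborel (P v w)" "\<And>k. sq_integrable lborel (P (\<phi> k) (grad (\<phi> k)))"
    unfolding P_def
    using sq_integrable_fst_indicator[OF sq_integrable_Pair[OF w_sq v_sq], of "{0<..<t}"]
      sq_integrable_fst_indicator[OF sq_integrable_Pair[OF g_sq \<phi>_sq], of "{0<..<t}"] t by simp_all
  have A_s: "sq_integrable lborel (\<lambda>z. indicator (UNIV \<times> {..<s}) z *\<^sub>R A z)"
    by (intro sq_integrable_indicator A_sq) (auto intro!: borel_open open_Times)
  have "(\<lambda>k. \<integral>z. P (\<phi> k) (grad (\<phi> k)) z \<bullet> (indicator (UNIV \<times> {..<s}) z *\<^sub>R A z) \<partial>lborel)
      \<longlonglongrightarrow> (\<integral>z. P v w z \<bullet> (indicator (UNIV \<times> {..<s}) z *\<^sub>R A z) \<partial>lborel)"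
  proof (rule tendsto_integral_inner[OF always_eventually P_sq(1) A_s])
    \<comment> \<open>The pair is constant in time on an interval of length \<open>t\<close>, so by
      Fubini its squared distance is \<open>t\<close> times the spatial one.\<close>
    have *: "(\<integral>z. (norm (P (\<phi> k) (grad (\<phi> k)) z - P v w z))\<^sup>2 \<partial>lborel)
        = t * ((LINT x:D|lborel. (\<phi> k x - v x)\<^sup>2) + (LINT x:D|lborel. (norm (grad (\<phi> k) x - w x))\<^sup>2))" for k
    proof -
      note d = sq_integrable_diff[OF \<phi>_sq[of k] v_sq] sq_integrable_diff[OF g_sq[of k] w_sq]
      let ?q = "\<lambda>x. (norm (indicator D x *\<^sub>R \<phi> k x - indicator D x *\<^sub>R v x))\<^sup>2
            + (norm (indicator D x *\<^sub>R grad (\<phi> k) x - indicator D x *\<^sub>R w x))\<^sup>2"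
      have q: "integrable lborel ?q"
        using d unfolding sq_integrable_def by auto
      have "(norm (P (\<phi> k) (grad (\<phi> k)) z - P v w z))\<^sup>2 = ?q (fst z) * indicator {0<..<t} (snd z)" for z
        by (auto simp: P_def indicator_def norm_Pair)
      then have "(\<integral>z. (norm (P (\<phi> k) (grad (\<phi> k)) z - P v w z))\<^sup>2 \<partial>lborel) = (\<integral>x. ?q x \<partial>lborel) * t"
        using integral_times_indicator_snd[OF q, of "{0<..<t}"] t by simp
      also have "(\<integral>x. ?q x \<partial>lborel) = (\<integral>x. (norm (indicator D x *\<^sub>R \<phi> k x - indicator D x *\<^sub>R v x))\<^sup>2 \<partial>lborel)
            + (\<integral>x. (norm (indicator D x *\<^sub>R grad (\<phi> k) x - indicator D x *\<^sub>R w x))\<^sup>2 \<partial>lborel)"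
        using d unfolding sq_integrable_def by (intro Bochner_Integration.integral_add) auto
      also have "(\<integral>x. (norm (indicator D x *\<^sub>R \<phi> k x - indicator D x *\<^sub>R v x))\<^sup>2 \<partial>lborel)
         = (LINT x:D|lborel. (\<phi> k x - v x)\<^sup>2)"
        unfolding set_lebesgue_integral_def
        by (intro Bochner_Integration.integral_cong) (auto simp: indicator_def)
      also have "(\<integral>x. (norm (indicator D x *\<^sub>R grad (\<phi> k) x - indicator D x *\<^sub>R w x))\<^sup>2 \<partial>lborel)
         = (LINT x:D|lborel. (norm (grad (\<phi> k) x - w x))\<^sup>2)"
        unfolding set_lebesgue_integral_def
        by (intro Bochner_Integration.integral_cong) (auto simp: indicator_def)
      finally show ?thesis by (simp add: mult.commute)
    qed
    show "(\<lambda>k. \<integral>z. (norm (P (\<phi> k) (grad (\<phi> k)) z - P v w z))\<^sup>2 \<partial>lborel) \<longlonglongrightarrow> 0"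
      unfolding * using tendsto_mult_right_zero[OF tendsto_add_zero[OF l1 l2], of t] by simp
  qed (use P_sq in auto)
  moreover have "(\<integral>z. P v w z \<bullet> (indicator (UNIV \<times> {..<s}) z *\<^sub>R A z) \<partial>lborel)
     = (\<integral>z. indicator {..<s} (snd z) * (A z \<bullet> (indicator D (fst z) *\<^sub>R (w (fst z), v (fst z)))) \<partial>lborel)"
    using A_zero by (intro Bochner_Integration.integral_cong)
      (auto simp: P_def indicator_def inner_commute)
  moreover have "(\<integral>z. P (\<phi> k) (grad (\<phi> k)) z \<bullet> (indicator (UNIV \<times> {..<s}) z *\<^sub>R A z) \<partial>lborel)
     = (LINT x:D|lborel. u x s * \<phi> k x)" for k
    unfolding weak[OF s \<phi>] using A_zero
    by (intro Bochner_Integration.integral_cong) (auto simp: P_def indicator_def inner_commute)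
  ultimately show ?thesis
    using LIMSEQ_unique[OF L] by simp
qed

section \<open>Testing the equation with the solution itself\<close>

definition W :: "(real^'n) \<times> real \<Rightarrow> (real^'n) \<times> real" where
  "W z = indicator (D \<times> {0<..<t}) z *\<^sub>R (Du (fst z) (snd z), u (fst z) (snd z))"

definition U :: "(real^'n) \<times> real \<Rightarrow> real" where "U z = snd (W z)"

lemma W_zero: "z \<notin> D \<times> {0<..<t} \<Longrightarrow> W z = 0" by (simp add: W_def zero_prod_def)

lemma U_zero: "z \<notin> D \<times> {0<..<t} \<Longrightarrow> U z = 0" by (simp add: U_def W_zero)

lemma U_eq: "U z = indicator (D \<times> {0<..<t}) z * u (fst z) (snd z)" by (simp add: U_def W_def)

lemma W_sq_integrable: "sq_integrable lborel W"
  using W_sq by (simp add: W_def[abs_def])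

lemma U_sq_integrable: "sq_integrable lborel U"
proof (rule sq_integrable_bound[OF W_sq_integrable, where C = 1])
  show "U \<in> borel_measurable lborel"
    using measurable_compose[OF sq_integrable_measurable[OF W_sq_integrable]
        borel_measurable_continuous_onI[OF continuous_on_snd[OF continuous_on_id]]]
    by (simp add: U_def[abs_def])
qed (auto simp: U_def norm_snd_le' simp flip: real_norm_def)

lemma U_slice_sq: "sq_integrable lborel (\<lambda>x. U (x, p))"
proof (cases "p \<in> {0<..<t}")
  case True
  then have "(\<lambda>x. U (x, p)) = (\<lambda>x. indicator D x *\<^sub>R u x p)"
    by (auto simp: U_eq indicator_def fun_eq_iff)
  with u_slice_sq[of p] True show ?thesis by simp
next
  case False
  then have "(\<lambda>x. U (x, p)) = (\<lambda>x. 0)" by (auto simp: U_zero)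
  then show ?thesis by (simp add: sq_integrable_def)
qed

text \<open>The gradient is controlled slicewise only at times where \<open>H10\<close> holds, that
  is almost everywhere, in contrast to \<open>u\<close>, whose slices are in L^2 at every
  time.\<close>

lemma W_slice_sq:
  assumes "q \<in> {0<..<t}" "H10 D (\<lambda>x. u x q) (\<lambda>x. Du x q)"
  shows "sq_integrable lborel (\<lambda>x. W (x, q))"
proof -
  have "(\<lambda>x. W (x, q)) = (\<lambda>x. (indicator D x *\<^sub>R Du x q, indicator D x *\<^sub>R u x q))"
    using assms(1) by (auto simp: W_def indicator_def fun_eq_iff)
  moreover have "sq_integrable lborel (\<lambda>x. indicator D x *\<^sub>R Du x q)"
    using assms(2) unfolding H10_def by (subst sq_integrable_indicator_iff) auto
  ultimately show ?thesis
    using sq_integrable_Pair u_slice_sq[of q] assms(1) by fastforce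
qed

lemma integral_U_U:
  assumes p: "p < t" and q: "q \<in> {0<..<t}" and H: "H10 D (\<lambda>x. u x q) (\<lambda>x. Du x q)"
  shows "(\<integral>x. U (x, p) * U (x, q) \<partial>lborel)
    = (\<integral>z. indicator {..<p} (snd z) * (A z \<bullet> W (fst z, q)) \<partial>lborel)"
proof (cases "p > 0")
  case True
  have "(\<integral>x. U (x, p) * U (x, q) \<partial>lborel) = (LINT x:D|lborel. u x p * u x q)"
    unfolding set_lebesgue_integral_def using True p q
    by (intro Bochner_Integration.integral_cong) (auto simp: U_eq indicator_def)
  also have "\<dots> = (\<integral>z. indicator {..<p} (snd z) * (A z \<bullet> (indicator D (fst z) *\<^sub>R (Du (fst z) q, u (fst z) q))) \<partial>lborel)"
    using True p by (intro weak_H10 H) auto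
  also have "\<dots> = (\<integral>z. indicator {..<p} (snd z) * (A z \<bullet> W (fst z, q)) \<partial>lborel)"
    using q by (intro Bochner_Integration.integral_cong) (auto simp: W_def indicator_def)
  finally show ?thesis .
next
  case False
  then have "indicator {..<p} (snd z) * (A z \<bullet> W (fst z, q)) = 0" for z
    using A_zero[of z] by (cases z) (auto simp: indicator_def)
  moreover have "U (x, p) = 0" for x using False by (intro U_zero) auto
  ultimately show ?thesis by (simp only: mult_zero_left Bochner_Integration.integral_zero)
qed

text \<open>Subtracting \<open>integral_U_U\<close> at \<open>s - h\<close> from the same identity
  at \<open>s\<close> leaves the window [s - h, s) of times of \<open>A\<close>. The substitution r
  = s - \<rho> expresses it by shifts with 0 < \<rho> <= h.\<close>

lemma integral_U_diff_slice:
  assumes h: "0 < h" and s: "s \<in> {0<..<t}" and H: "H10 D (\<lambda>x. u x s) (\<lambda>x. Du x s)"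
  shows "(\<integral>x. (U (x, s) - U (x, s - h)) * U (x, s) \<partial>lborel)
    = (\<integral>x. (\<integral>\<rho>. indicator {0<..h} \<rho> * (A (x, s - \<rho>) \<bullet> W (x, s)) \<partial>lborel) \<partial>lborel)"
proof -
  have iU: "integrable lborel (\<lambda>x. U (x, p) * U (x, s))" for p
    using integrable_inner_sq[OF U_slice_sq[of p] U_slice_sq[of s]] by simp
  have iA: "integrable lborel (\<lambda>z. indicator {..<p} (snd z) * (A z \<bullet> W (fst z, s)))" for p
  proof -
    have "sq_integrable lborel (\<lambda>z. indicator (UNIV \<times> {..<p}) z *\<^sub>R (A z))"
      by (intro sq_integrable_indicator A_sq) (auto intro!: borel_open open_Times)
    moreover have "sq_integrable lborel (\<lambda>z. indicator {0<..<t} (snd z) *\<^sub>R W (fst z, s))"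
      using sq_integrable_fst_indicator[OF W_slice_sq[OF s H], of "{0<..<t}"] t by simp
    ultimately have "integrable lborel (\<lambda>z. (indicator (UNIV \<times> {..<p}) z *\<^sub>R (A z)) \<bullet>
        (indicator {0<..<t} (snd z) *\<^sub>R W (fst z, s)))"
      by (rule integrable_inner_sq)
    also have "(\<lambda>z. (indicator (UNIV \<times> {..<p}) z *\<^sub>R (A z)) \<bullet> (indicator {0<..<t} (snd z) *\<^sub>R W (fst z, s)))
       = (\<lambda>z. indicator {..<p} (snd z) * (A z \<bullet> W (fst z, s)))"
    proof (rule ext)
      fix z
      show "(indicator (UNIV \<times> {..<p}) z *\<^sub>R (A z)) \<bullet> (indicator {0<..<t} (snd z) *\<^sub>R W (fst z, s))
          = indicator {..<p} (snd z) * (A z \<bullet> W (fst z, s))"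
        using A_zero[of z] by (cases "z \<in> D \<times> {0<..<t}") (auto simp: indicator_def)
    qed
    finally show ?thesis .
  qed
  let ?g = "\<lambda>z::(real^'n) \<times> real. indicator {s-h..<s} (snd z) * (A z \<bullet> W (fst z, s))"
  have g: "?g = (\<lambda>z. indicator {..<s} (snd z) * (A z \<bullet> W (fst z, s)) - indicator {..<s-h} (snd z) * (A z \<bullet> W (fst z, s)))"
    using h by (auto simp: indicator_def fun_eq_iff)
  have ig: "integrable (lborel \<Otimes>\<^sub>M lborel) ?g"
    unfolding g lborel_prod by (intro Bochner_Integration.integrable_diff iA)
  have "(\<integral>x. (U (x, s) - U (x, s - h)) * U (x, s) \<partial>lborel)
     = (\<integral>x. U (x, s) * U (x, s) \<partial>lborel) - (\<integral>x. U (x, s - h) * U (x, s) \<partial>lborel)"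
    unfolding left_diff_distrib by (intro Bochner_Integration.integral_diff iU)
  also have "\<dots> = integral\<^sup>L lborel ?g"
    unfolding g using iA integral_U_U[OF _ s H, of s] integral_U_U[OF _ s H, of "s - h"] s h by simp
  also have "\<dots> = (\<integral>x. (\<integral>r. ?g (x, r) \<partial>lborel) \<partial>lborel)"
    using lborel_pair.integral_fst'[OF ig] by (simp add: lborel_prod)
  also have "\<dots> = (\<integral>x. (\<integral>\<rho>. indicator {0<..h} \<rho> * (A (x, s - \<rho>) \<bullet> W (x, s)) \<partial>lborel) \<partial>lborel)"
  proof (rule Bochner_Integration.integral_cong[OF refl])
    fix x
    have "(\<integral>r. ?g (x, r) \<partial>lborel) = (\<integral>\<rho>. ?g (x, s + (-1) * \<rho>) \<partial>lborel)"
      using lborel_integral_real_affine[of "-1" "\<lambda>r. ?g (x, r)" s] by simp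
    also have "\<dots> = (\<integral>\<rho>. indicator {0<..h} \<rho> * (A (x, s - \<rho>) \<bullet> W (x, s)) \<partial>lborel)"
      by (intro Bochner_Integration.integral_cong) (auto simp: indicator_def)
    finally show "(\<integral>r. ?g (x, r) \<partial>lborel) = \<dots>" .
  qed
  finally show ?thesis .
qed

text \<open>The slice identity is integrated over \<open>s\<close> with the weight, then the shift
  \<rho> is moved outside by Fubini. For fixed \<rho> the inner integral is an L^2 pairing of a
  translate of \<open>A\<close> with a fixed function, ready for the continuity of
  translations.\<close>

lemma integral_U_diff:
  assumes K: "0 \<le> K" and h: "0 < h"
  defines "V \<equiv> \<lambda>z. exp (- 2 * K * snd z) *\<^sub>R W z"
  shows "sq_integrable lborel V"
    and "integrable lborel (\<lambda>z. exp (- 2 * K * snd z) * ((U z - U (z - (0, h))) * U z))"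
    and "integrable lborel (\<lambda>\<rho>. indicator {0<..h} \<rho> * (\<integral>z. A (z - (0, \<rho>)) \<bullet> V z \<partial>lborel))"
    and "(\<integral>z. exp (- 2 * K * snd z) * ((U z - U (z - (0, h))) * U z) \<partial>lborel)
      = (\<integral>\<rho>. indicator {0<..h} \<rho> * (\<integral>z. A (z - (0, \<rho>)) \<bullet> V z \<partial>lborel) \<partial>lborel)"
proof -
  have snd_m [measurable]: "snd \<in> borel_measurable (borel :: ((real^'n) \<times> real) measure)"
    by (intro borel_measurable_continuous_onI continuous_intros)
  have [measurable]: "A \<in> borel_measurable borel" "W \<in> borel_measurable borel" "U \<in> borel_measurable borel"
    using A_sq W_sq_integrable U_sq_integrable by (auto simp: sq_integrable_def)
  \<comment> \<open>At negative times the weight may exceed 1, but there \<open>W\<close>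
    vanishes.\<close>
  have exp_le: "exp (- 2 * K * snd z) \<le> 1" if "z \<in> D \<times> {0<..<t}" for z
    using that K by (auto intro!: mult_nonneg_nonneg)
  show V: "sq_integrable lborel V"
  proof (rule sq_integrable_bound[OF W_sq_integrable, where C = 1])
    show "V \<in> borel_measurable lborel" unfolding V_def by measurable
    show "AE z in lborel. norm (V z) \<le> 1 * norm (W z)"
    proof (intro AE_I2)
      fix z
      show "norm (V z) \<le> 1 * norm (W z)"
        using mult_right_mono[OF exp_le[of z] norm_ge_zero[of "W z"]] W_zero[of z] unfolding V_def
        by (cases "z \<in> D \<times> {0<..<t}") simp_all
    qed
  qed
  have [measurable]: "V \<in> borel_measurable borel" using V by (auto simp: sq_integrable_def)
  have A_tr: "sq_integrable lborel (\<lambda>z. A (z - (0, \<rho>)))" for \<rho>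
    using sq_integrable_translate[OF A_sq, of "- (0, \<rho>)"] by (simp del: uminus_Pair)
  define H where "H = (\<lambda>(\<rho>, z). indicator {0<..h} \<rho> * (A (z - (0, \<rho>)) \<bullet> V z))"
  have H_m: "H \<in> borel_measurable (lborel \<Otimes>\<^sub>M lborel)"
  proof -
    have [measurable]: "(\<lambda>p::real \<times> (real^'n) \<times> real. snd p - (0, fst p)) \<in> borel_measurable borel"
      "snd \<in> measurable (borel :: (real \<times> (real^'n) \<times> real) measure) borel"
      "fst \<in> measurable (borel :: (real \<times> (real^'n) \<times> real) measure) borel"
      by (intro borel_measurable_continuous_onI continuous_intros)+
    have "(\<lambda>p. indicator {0<..h} (fst p) * (A (snd p - (0, fst p)) \<bullet> V (snd p))) \<in> borel_measurable borel"
      by measurable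
    then show ?thesis by (simp add: H_def lborel_prod case_prod_unfold)
  qed
  have H_i: "integrable (lborel \<Otimes>\<^sub>M lborel) H"
  proof (rule lborel_pair.Fubini_integrable[OF H_m])
    show "AE \<rho> in lborel. integrable lborel (\<lambda>z. H (\<rho>, z))"
      unfolding H_def using integrable_inner_sq[OF A_tr V] by simp
    \<comment> \<open>Translation preserves the L^2 norm of \<open>A\<close>, so one constant bounds
      the inner integral for every shift.\<close>
    define C where "C = (\<integral>z. (norm (A z))\<^sup>2 \<partial>lborel) + (\<integral>z. (norm (V z))\<^sup>2 \<partial>lborel)"
    have "integrable lborel (\<lambda>\<rho>. C * indicator {0<..h} \<rho>)" using h by simp
    then show "integrable lborel (\<lambda>\<rho>. \<integral>z. norm (H (\<rho>, z)) \<partial>lborel)"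
    proof (rule Bochner_Integration.integrable_bound)
      show "(\<lambda>\<rho>. \<integral>z. norm (H (\<rho>, z)) \<partial>lborel) \<in> borel_measurable lborel"
        using H_m by (intro lborel.borel_measurable_lebesgue_integral) auto
      show "AE \<rho> in lborel. norm (\<integral>z. norm (H (\<rho>, z)) \<partial>lborel) \<le> norm (C * indicator {0<..h} \<rho>)"
      proof (intro AE_I2)
        fix \<rho> :: real
        have iA: "integrable lborel (\<lambda>z. (norm (A (z - (0, \<rho>))))\<^sup>2)" "integrable lborel (\<lambda>z. (norm (V z))\<^sup>2)"
          using A_tr V by (auto simp: sq_integrable_def)
        have "(\<integral>z. \<bar>A (z - (0, \<rho>)) \<bullet> V z\<bar> \<partial>lborel) \<le> (\<integral>z. (norm (A (z - (0, \<rho>))))\<^sup>2 + (norm (V z))\<^sup>2 \<partial>lborel)"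
        proof (rule integral_mono)
          fix z
          have "\<bar>A (z - (0, \<rho>)) \<bullet> V z\<bar> \<le> norm (A (z - (0, \<rho>))) * norm (V z)" by (rule Cauchy_Schwarz_ineq2)
          also have "\<dots> \<le> (norm (A (z - (0, \<rho>))))\<^sup>2 + (norm (V z))\<^sup>2"
            using sum_squares_bound[of "norm (A (z - (0, \<rho>)))" "norm (V z)"]
              mult_nonneg_nonneg[OF norm_ge_zero[of "A (z - (0, \<rho>))"] norm_ge_zero[of "V z"]] by linarith
          finally show "\<bar>A (z - (0, \<rho>)) \<bullet> V z\<bar> \<le> (norm (A (z - (0, \<rho>))))\<^sup>2 + (norm (V z))\<^sup>2" .
        qed (use iA integrable_inner_sq[OF A_tr V] in auto)
        also have "\<dots> = C"
          using iA integral_lborel_translate[of "\<lambda>z. (norm (A z))\<^sup>2" "- (0, \<rho>)"] by (simp add: C_def del: uminus_Pair)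
        finally have "(\<integral>z. \<bar>A (z - (0, \<rho>)) \<bullet> V z\<bar> \<partial>lborel) \<le> C" .
        then show "norm (\<integral>z. norm (H (\<rho>, z)) \<partial>lborel) \<le> norm (C * indicator {0<..h} \<rho>)"
          by (auto simp: H_def indicator_def)
      qed
    qed
  qed
  have Hc: "(\<integral>z. H (\<rho>, z) \<partial>lborel) = indicator {0<..h} \<rho> * (\<integral>z. A (z - (0, \<rho>)) \<bullet> V z \<partial>lborel)" for \<rho>
    by (simp add: H_def)
  show "integrable lborel (\<lambda>\<rho>. indicator {0<..h} \<rho> * (\<integral>z. A (z - (0, \<rho>)) \<bullet> V z \<partial>lborel))"
    using lborel_pair.integrable_fst'[OF H_i] by (simp add: Hc)
  define k where "k z = (\<integral>\<rho>. H (\<rho>, z) \<partial>lborel)" for z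
  have H_i': "integrable (lborel \<Otimes>\<^sub>M lborel) (case_prod (\<lambda>\<rho> z. H (\<rho>, z)))"
    using H_i by simp
  have k_i: "integrable (lborel \<Otimes>\<^sub>M lborel) k"
    using lborel_pair.integrable_snd[OF H_i'] by (simp add: k_def[abs_def] lborel_prod)
  have "integrable lborel (\<lambda>z. ((U z - U (z - (0, h))) \<bullet> (snd (V z))))"
  proof (rule integrable_inner_sq)
    show "sq_integrable lborel (\<lambda>z. U z - U (z - (0, h)))"
      using sq_integrable_diff[OF U_sq_integrable sq_integrable_translate[OF U_sq_integrable, of "- (0, h)"]] by (simp del: uminus_Pair)
    show "sq_integrable lborel (\<lambda>z. snd (V z))"
      by (rule sq_integrable_bound[OF V, where C = 1]) (auto simp: norm_snd_le' simp flip: real_norm_def)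
  qed
  also have "(\<lambda>z. ((U z - U (z - (0, h))) \<bullet> (snd (V z))))
      = (\<lambda>z. exp (- 2 * K * snd z) * ((U z - U (z - (0, h))) * U z))"
    by (simp add: V_def U_def fun_eq_iff)
  finally show L_i: "integrable lborel (\<lambda>z. exp (- 2 * K * snd z) * ((U z - U (z - (0, h))) * U z))" .
  let ?L = "\<lambda>z. exp (- 2 * K * snd z) * ((U z - U (z - (0, h))) * U z)"
  have L_i': "integrable (lborel \<Otimes>\<^sub>M lborel) (case_prod (\<lambda>x s. ?L (x, s)))"
    using L_i by (simp add: lborel_prod case_prod_unfold del: diff_Pair)
  have k_i': "integrable (lborel \<Otimes>\<^sub>M lborel) (case_prod (\<lambda>x s. k (x, s)))"
    using k_i by simp
  have "(\<integral>z. ?L z \<partial>lborel) = (\<integral>s. (\<integral>x. ?L (x, s) \<partial>lborel) \<partial>lborel)"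
    using lborel_pair.integral_snd[OF L_i'] by (simp add: lborel_prod case_prod_unfold del: diff_Pair)
  also have "\<dots> = (\<integral>s. (\<integral>x. k (x, s) \<partial>lborel) \<partial>lborel)"
  proof (rule integral_cong_AE)
    show "(\<lambda>s. \<integral>x. ?L (x, s) \<partial>lborel) \<in> borel_measurable lborel"
      using lborel_pair.integrable_snd[OF L_i'] by (rule borel_measurable_integrable)
    show "(\<lambda>s. \<integral>x. k (x, s) \<partial>lborel) \<in> borel_measurable lborel"
      using lborel_pair.integrable_snd[OF k_i'] by (rule borel_measurable_integrable)
    \<comment> \<open>Only almost every slice of \<open>u\<close> is known to be an admissible test
      function.\<close>
    show "AE s in lborel. (\<integral>x. ?L (x, s) \<partial>lborel) = (\<integral>x. k (x, s) \<partial>lborel)"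
      using H1
    proof eventually_elim
      case (elim s)
      show ?case
      proof (cases "s \<in> {0<..<t}")
        case True
        have "k (x, s) = (\<integral>\<rho>. exp (- 2 * K * s) * (indicator {0<..h} \<rho> * (A (x, s - \<rho>) \<bullet> W (x, s))) \<partial>lborel)" for x
          unfolding k_def H_def V_def by (intro Bochner_Integration.integral_cong) simp_all
        with integral_U_diff_slice[OF h True] elim True show ?thesis by simp
      next
        case False
        then have "U (x, s) = 0" "W (x, s) = 0" for x by (auto simp: U_zero W_zero)
        then show ?thesis by (simp add: k_def H_def V_def)
      qed
    qed
  qed
  also have "\<dots> = (\<integral>z. k z \<partial>lborel)"
    using lborel_pair.integral_snd[OF k_i'] by (simp add: lborel_prod)
  also have "\<dots> = (\<integral>\<rho>. (\<integral>z. H (\<rho>, z) \<partial>lborel) \<partial>lborel)"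
    unfolding k_def using lborel_pair.Fubini_integral[OF H_i'] .
  also have "\<dots> = (\<integral>\<rho>. indicator {0<..h} \<rho> * (\<integral>z. A (z - (0, \<rho>)) \<bullet> V z \<partial>lborel) \<partial>lborel)"
    by (simp add: Hc)
  finally show "(\<integral>z. ?L z \<partial>lborel) = \<dots>" .
qed

text \<open>Writes |u(r)|^2 as |u(r) - u(s)|^2 + 2 u(r) . u(s) - |u(s)|^2 under the integral; the
  first term tends to 0 by \<open>u_cont\<close>, the mixed one by
  \<open>tendsto_integral_inner\<close>.\<close>

lemma energy_continuous: "continuous_on {0..t} (\<lambda>s. LINT x:D|lborel. (u x s)\<^sup>2)"
  unfolding continuous_on_def
proof
  fix s assume s: "s \<in> {0..t}"
  let ?F = "at s within {0..t}" and ?f = "\<lambda>r x. indicator D x *\<^sub>R u x r"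
  have F: "\<forall>\<^sub>F r in ?F. r \<in> {0..t}" by (simp add: eventually_at_filter)
  have "((\<lambda>r. \<integral>x. (norm (?f r x - ?f s x))\<^sup>2 \<partial>lborel) \<longlongrightarrow> 0) ?F"
  proof -
    have "(\<integral>x. (norm (?f r x - ?f s x))\<^sup>2 \<partial>lborel) = (LINT x:D|lborel. (u x r - u x s)\<^sup>2)" for r
      unfolding set_lebesgue_integral_def
      by (intro Bochner_Integration.integral_cong) (auto simp: indicator_def)
    with u_cont[OF s] show ?thesis by simp
  qed
  note lim = this
  have "((\<lambda>r. \<integral>x. ?f r x \<bullet> ?f s x \<partial>lborel) \<longlongrightarrow> (\<integral>x. ?f s x \<bullet> ?f s x \<partial>lborel)) ?F"
    by (intro tendsto_integral_inner u_slice_sq s lim eventually_mono[OF F])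
  from tendsto_add[OF lim tendsto_diff[OF tendsto_mult_left[OF this, of 2] tendsto_const[of "\<integral>x. ?f s x \<bullet> ?f s x \<partial>lborel"]]]
  have "((\<lambda>r. (\<integral>x. (norm (?f r x - ?f s x))\<^sup>2 \<partial>lborel)
         + (2 * (\<integral>x. ?f r x \<bullet> ?f s x \<partial>lborel) - (\<integral>x. ?f s x \<bullet> ?f s x \<partial>lborel)))
      \<longlongrightarrow> (\<integral>x. ?f s x \<bullet> ?f s x \<partial>lborel)) ?F" by simp
  moreover have "\<forall>\<^sub>F r in ?F. (\<integral>x. (norm (?f r x - ?f s x))\<^sup>2 \<partial>lborel)
         + (2 * (\<integral>x. ?f r x \<bullet> ?f s x \<partial>lborel) - (\<integral>x. ?f s x \<bullet> ?f s x \<partial>lborel)) = (\<integral>x. ?f r x \<bullet> ?f r x \<partial>lborel)"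
    using F
  proof eventually_elim
    case (elim r)
    note i = integrable_inner_sq[OF u_slice_sq[OF elim] u_slice_sq[OF elim]]
      integrable_inner_sq[OF u_slice_sq[OF elim] u_slice_sq[OF s]]
      integrable_inner_sq[OF u_slice_sq[OF s] u_slice_sq[OF s]]
    have "(\<integral>x. (norm (?f r x - ?f s x))\<^sup>2 \<partial>lborel)
       = (\<integral>x. ?f r x \<bullet> ?f r x - 2 * (?f r x \<bullet> ?f s x) + ?f s x \<bullet> ?f s x \<partial>lborel)"
      by (intro Bochner_Integration.integral_cong) (auto simp: power2_eq_square algebra_simps)
    also have "\<dots> = (\<integral>x. ?f r x \<bullet> ?f r x \<partial>lborel) - 2 * (\<integral>x. ?f r x \<bullet> ?f s x \<partial>lborel) + (\<integral>x. ?f s x \<bullet> ?f s x \<partial>lborel)"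
      using i by (simp del: inner_real_def)
    finally show ?case by simp
  qed
  ultimately have "((\<lambda>r. \<integral>x. ?f r x \<bullet> ?f r x \<partial>lborel) \<longlongrightarrow> (\<integral>x. ?f s x \<bullet> ?f s x \<partial>lborel)) ?F"
    by (rule Lim_transform_eventually)
  moreover have "(\<integral>x. ?f r x \<bullet> ?f r x \<partial>lborel) = (LINT x:D|lborel. (u x r)\<^sup>2)" for r
    unfolding set_lebesgue_integral_def
    by (intro Bochner_Integration.integral_cong) (auto simp: indicator_def power2_eq_square)
  ultimately show "((\<lambda>r. LINT x:D|lborel. (u x r)\<^sup>2) \<longlongrightarrow> (LINT x:D|lborel. (u x s)\<^sup>2)) ?F" by simp
qed

lemma integrable_weighted_U_square:
  assumes K: "0 \<le> K"
  shows "integrable lborel (\<lambda>z. exp (- 2 * K * snd z) * (U z)\<^sup>2)"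
proof -
  have "integrable lborel (\<lambda>z. snd (exp (- 2 * K * snd z) *\<^sub>R W z) \<bullet> U z)"
  proof (rule integrable_inner_sq[OF _ U_sq_integrable])
    have m: "snd \<in> borel_measurable (borel :: ((real^'n) \<times> real) measure)"
      by (intro borel_measurable_continuous_onI continuous_intros)
    note V = integral_U_diff(1)[OF K zero_less_one]
    show "sq_integrable lborel (\<lambda>z. snd (exp (- 2 * K * snd z) *\<^sub>R W z))"
    proof (rule sq_integrable_bound[OF V, where C = 1])
      show "(\<lambda>z. snd (exp (- 2 * K * snd z) *\<^sub>R W z)) \<in> borel_measurable lborel"
        using measurable_compose[OF sq_integrable_measurable[OF V] m] by simp
    qed (rule AE_I2, simp only: mult_1 norm_snd_le')
  qed
  then show ?thesis by (simp add: U_def power2_eq_square mult.assoc)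
qed

text \<open>Turns a space-time integral into the time integral of a continuous function, to which
  the fundamental theorem of calculus applies.\<close>

lemma weighted_U_square_integral:
  assumes K: "0 \<le> K" and r: "r \<in> {0..t}"
  shows "(\<integral>z. indicator {..<r} (snd z) * (exp (- 2 * K * snd z) * (U z)\<^sup>2) \<partial>lborel)
    = integral {0..r} (\<lambda>s. exp (- 2 * K * s) * (LINT x:D|lborel. (u x s)\<^sup>2))"
proof -
  let ?\<Phi> = "\<lambda>s. LINT x:D|lborel. (u x s)\<^sup>2"
  let ?g = "\<lambda>z. indicator {..<r} (snd z) * (exp (- 2 * K * snd z) * (U z)\<^sup>2)"
  have "integrable lborel (\<lambda>z. indicator (UNIV \<times> {..<r}) z *\<^sub>R (exp (- 2 * K * snd z) * (U z)\<^sup>2))"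
    by (intro integrable_mult_indicator integrable_weighted_U_square K) (auto intro!: borel_open open_Times)
  also have "(\<lambda>z. indicator (UNIV \<times> {..<r}) z *\<^sub>R (exp (- 2 * K * snd z) * (U z)\<^sup>2)) = ?g"
    by (auto simp: indicator_def fun_eq_iff)
  finally have "integrable (lborel \<Otimes>\<^sub>M lborel) (case_prod (\<lambda>x s. ?g (x, s)))"
    by (simp add: lborel_prod case_prod_unfold)
  from lborel_pair.integral_snd[OF this]
  have "(\<integral>z. ?g z \<partial>lborel) = (\<integral>s. (\<integral>x. ?g (x, s) \<partial>lborel) \<partial>lborel)"
    by (simp add: lborel_prod case_prod_unfold)
  also have "\<dots> = (LINT s:{0<..<r}|lborel. exp (- 2 * K * s) * ?\<Phi> s)"
    unfolding set_lebesgue_integral_def[of lborel "{0<..<r}"]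
  proof (rule Bochner_Integration.integral_cong[OF refl])
    fix s
    have "(\<integral>x. (U (x, s))\<^sup>2 \<partial>lborel) = ?\<Phi> s" if "0 < s" "s < r"
      unfolding set_lebesgue_integral_def using that r
      by (intro Bochner_Integration.integral_cong) (auto simp: U_eq indicator_def)
    moreover have "U (x, s) = 0" if "s \<le> 0" for x
      using that by (intro U_zero) auto
    ultimately show "(\<integral>x. ?g (x, s) \<partial>lborel) = indicator {0<..<r} s *\<^sub>R (exp (- 2 * K * s) * ?\<Phi> s)"
      by (auto simp: indicator_def not_less)
  qed
  also have "\<dots> = integral {0<..<r} (\<lambda>s. exp (- 2 * K * s) * ?\<Phi> s)"
  proof (rule set_borel_integral_eq_integral(2))
    have "continuous_on {0..r} (\<lambda>s. exp (- 2 * K * s) * ?\<Phi> s)"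
      using r by (intro continuous_intros continuous_on_subset[OF energy_continuous]) auto
    from borel_integrable_atLeastAtMost'[OF this]
    show "set_integrable lborel {0<..<r} (\<lambda>s. exp (- 2 * K * s) * ?\<Phi> s)"
      by (rule set_integrable_subset) auto
  qed
  also have "\<dots> = integral {0..r} (\<lambda>s. exp (- 2 * K * s) * ?\<Phi> s)"
    by (rule integral_open_interval_real[symmetric])
  finally show ?thesis .
qed

text \<open>The idea is \<open>a\<^sup>2 - b\<^sup>2 \<le> 2 (a - b) a\<close> with \<open>a = U(s)\<close> and \<open>b = U(s - h)\<close>, integrated against
  the weight.\<close>

lemma weighted_energy_step:
  assumes K: "0 \<le> K" and h: "0 < h"
  defines "J \<equiv> \<lambda>r. \<integral>z. indicator {..<r} (snd z) * (exp (- 2 * K * snd z) * (U z)\<^sup>2) \<partial>lborel"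
  shows "J t - exp (- 2 * K * h) * J (t - h)
    \<le> 2 * (\<integral>\<rho>. indicator {0<..h} \<rho> * (\<integral>z. A (z - (0, \<rho>)) \<bullet> (exp (- 2 * K * snd z) *\<^sub>R W z) \<partial>lborel) \<partial>lborel)"
proof -
  let ?e = "\<lambda>z::(real^'n) \<times> real. exp (- 2 * K * snd z)"
  note i = integrable_weighted_U_square[OF K]
  have J: "integrable lborel (\<lambda>z. indicator {..<r} (snd z) * (?e z * (U z)\<^sup>2))" for r
  proof -
    have "integrable lborel (\<lambda>z. indicator (UNIV \<times> {..<r}) z *\<^sub>R (?e z * (U z)\<^sup>2))"
      by (intro integrable_mult_indicator i) (auto intro!: borel_open open_Times)
    also have "(\<lambda>z. indicator (UNIV \<times> {..<r}) z *\<^sub>R (?e z * (U z)\<^sup>2)) = (\<lambda>z. indicator {..<r} (snd z) * (?e z * (U z)\<^sup>2))"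
      by (auto simp: indicator_def fun_eq_iff)
    finally show ?thesis .
  qed
  \<comment> \<open>The cutoff at \<open>t\<close> matters: the translate lives up to time t + h,
    and integrating all of it would give J t in place of J (t - h), losing the energy at the final
    time.\<close>
  let ?g = "\<lambda>z. indicator {..<t} (snd z) * (?e z * (U (z - (0, h)))\<^sup>2)"
  have g: "?g = (\<lambda>z. (\<lambda>z. exp (- 2 * K * h) * (indicator {..<t - h} (snd z) * (?e z * (U z)\<^sup>2))) (z + - (0, h)))"
  proof (rule ext)
    fix z :: "(real^'n) \<times> real"
    have "?e z = exp (- 2 * K * h) * ?e (z + - (0, h))"
      by (simp add: exp_add[symmetric] algebra_simps)
    moreover have "indicat_real {..<t} (snd z) = indicator {..<t - h} (snd (z + - (0, h)))"
      by (auto simp: indicator_def)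
    ultimately show "?g z = (\<lambda>z. exp (- 2 * K * h) * (indicator {..<t - h} (snd z) * (?e z * (U z)\<^sup>2))) (z + - (0, h))"
      by (simp del: uminus_Pair)
  qed
  have g_i: "integrable lborel ?g"
    unfolding g by (rule integrable_lborel_translate) (intro integrable_mult_right J)
  have g_eq: "(\<integral>z. ?g z \<partial>lborel) = exp (- 2 * K * h) * J (t - h)"
    unfolding g J_def
    by (subst integral_lborel_translate) (use borel_measurable_integrable[OF J] in simp_all)
  note L = integral_U_diff[OF K h]
  have "J t - exp (- 2 * K * h) * J (t - h)
     = (\<integral>z. indicator {..<t} (snd z) * (?e z * (U z)\<^sup>2) - ?g z \<partial>lborel)"
    using J[of t] g_i g_eq by (simp add: J_def)
  also have "\<dots> \<le> (\<integral>z. 2 * (?e z * ((U z - U (z - (0, h))) * U z)) \<partial>lborel)"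
  proof (rule integral_mono)
    show "integrable lborel (\<lambda>z. indicator {..<t} (snd z) * (?e z * (U z)\<^sup>2) - ?g z)"
      by (intro Bochner_Integration.integrable_diff J g_i)
    show "integrable lborel (\<lambda>z. 2 * (?e z * ((U z - U (z - (0, h))) * U z)))"
      by (intro integrable_mult_right L(2))
    fix z
    have "?e z * ((U z)\<^sup>2 - (U (z - (0, h)))\<^sup>2) \<le> ?e z * (2 * ((U z - U (z - (0, h))) * U z))"
      using zero_le_power2[of "U z - U (z - (0, h))"]
      by (intro mult_left_mono) (auto simp: power2_eq_square algebra_simps)
    moreover have "U z = 0" if "\<not> snd z < t" using that by (intro U_zero) (auto simp: mem_Times_iff)
    ultimately show "indicator {..<t} (snd z) * (?e z * (U z)\<^sup>2) - ?g z \<le> 2 * (?e z * ((U z - U (z - (0, h))) * U z))"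
      by (cases "snd z < t") (simp_all add: algebra_simps)
  qed
  also have "\<dots> = 2 * (\<integral>\<rho>. indicator {0<..h} \<rho> * (\<integral>z. A (z - (0, \<rho>)) \<bullet> (?e z *\<^sub>R W z) \<partial>lborel) \<partial>lborel)"
    using L(4) by simp
  finally show ?thesis .
qed

text \<open>Divide \<open>weighted_energy_step\<close> by \<open>h\<close> and let \<open>h\<close>
  tend to 0. The left side becomes the left derivative at \<open>t\<close> of an auxiliary function;
  the right side is an average over (0, h] of a function of the shift that is continuous at
  0.\<close>

theorem energy_inequality:
  assumes K: "0 \<le> K"
  shows "exp (- 2 * K * t) * (LINT x:D|lborel. (u x t)\<^sup>2)
      + 2 * K * (\<integral>z. exp (- 2 * K * snd z) * (U z)\<^sup>2 \<partial>lborel)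
    \<le> 2 * (\<integral>z. exp (- 2 * K * snd z) * (A z \<bullet> W z) \<partial>lborel)"
proof -
  let ?\<Phi> = "\<lambda>s. LINT x:D|lborel. (u x s)\<^sup>2"
  define J where "J r = integral {0..r} (\<lambda>s. exp (- 2 * K * s) * ?\<Phi> s)" for r
  \<comment> \<open>Chosen so that q t - q (t - h) is the left side of
    \<open>weighted_energy_step\<close>; differentiating the exponential supplies the term with 2
    K.\<close>
  define q where "q r = exp (2 * K * (r - t)) * J r" for r
  define c where "c \<rho> = (\<integral>z. A (z - (0, \<rho>)) \<bullet> (exp (- 2 * K * snd z) *\<^sub>R W z) \<partial>lborel)" for \<rho>
  have "(J has_real_derivative exp (- 2 * K * t) * ?\<Phi> t) (at t within {0..t})"
    unfolding J_def[abs_def] using t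
    by (intro integral_has_real_derivative continuous_intros energy_continuous) auto
  then have "(q has_real_derivative exp (- 2 * K * t) * ?\<Phi> t + 2 * K * J t) (at t within {0..t})"
    unfolding q_def[abs_def] by (auto intro!: derivative_eq_intros)
  then have q': "((\<lambda>r. (q r - q t) / (r - t)) \<longlongrightarrow> exp (- 2 * K * t) * ?\<Phi> t + 2 * K * J t) (at t within {0..t})"
    by (simp add: has_field_derivative_iff)
  have Jt: "J t = (\<integral>z. exp (- 2 * K * snd z) * (U z)\<^sup>2 \<partial>lborel)"
  proof -
    have "indicator {..<t} (snd z) * (exp (- 2 * K * snd z) * (U z)\<^sup>2) = exp (- 2 * K * snd z) * (U z)\<^sup>2" for z
      using U_zero[of z] by (cases z; cases "snd z < t") auto
    then show ?thesis
      using weighted_U_square_integral[OF K, of t] t unfolding J_def by (simp only: atLeastAtMost_iff) simp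
  qed
  \<comment> \<open>Only \<open>A\<close> is shifted while the weighted \<open>W\<close> stays
    fixed, so continuity of translations in L^2 gives continuity at 0.\<close>
  have c_lim: "(c \<longlongrightarrow> c 0) (at 0)"
    unfolding LIMSEQ_SEQ_conv[symmetric]
  proof (intro allI impI, elim conjE)
    fix S :: "nat \<Rightarrow> real" assume "S \<longlonglongrightarrow> 0"
    then have "(\<lambda>n. - (0::real^'n, S n)) \<longlonglongrightarrow> - (0, 0)" by (intro tendsto_intros)
    then have S: "(\<lambda>n. - (0::real^'n, S n)) \<longlonglongrightarrow> 0" by (simp add: zero_prod_def)
    show "(\<lambda>n. c (S n)) \<longlonglongrightarrow> c 0"
      using tendsto_inner_translate[OF A_sq integral_U_diff(1)[OF K zero_less_one] S]
      unfolding c_def by (simp del: uminus_Pair flip: zero_prod_def)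
  qed
  have "exp (- 2 * K * t) * ?\<Phi> t + 2 * K * J t \<le> 2 * (c 0 + \<epsilon>)" if "\<epsilon> > 0" for \<epsilon>
  proof -
    have "\<forall>\<^sub>F \<rho> in at 0. c \<rho> < c 0 + \<epsilon>"
      using order_tendstoD(2)[OF c_lim, of "c 0 + \<epsilon>"] that by simp
    then obtain \<eta> where \<eta>: "\<eta> > 0" "\<And>\<rho>. \<rho> \<noteq> 0 \<Longrightarrow> \<bar>\<rho>\<bar> < \<eta> \<Longrightarrow> c \<rho> < c 0 + \<epsilon>"
      unfolding eventually_at by (auto simp: dist_real_def)
    have step: "(q r - q t) / (r - t) \<le> 2 * (c 0 + \<epsilon>)" if r: "0 < r" "r < t" "t - r < \<eta>" for r
    proof -
      define h where "h = t - r"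
      have h: "0 < h" "h < t" "h < \<eta>" using r by (auto simp: h_def)
      have "q t - q r = (\<integral>z. indicator {..<t} (snd z) * (exp (- 2 * K * snd z) * (U z)\<^sup>2) \<partial>lborel)
         - exp (- 2 * K * h) * (\<integral>z. indicator {..<t-h} (snd z) * (exp (- 2 * K * snd z) * (U z)\<^sup>2) \<partial>lborel)"
        using weighted_U_square_integral[OF K, of t] weighted_U_square_integral[OF K, of "t - h"] t h
        by (simp add: q_def J_def h_def algebra_simps)
      also have "\<dots> \<le> 2 * (\<integral>\<rho>. indicator {0<..h} \<rho> * c \<rho> \<partial>lborel)"
        unfolding c_def by (rule weighted_energy_step[OF K h(1)])
      also have "(\<integral>\<rho>. indicator {0<..h} \<rho> * c \<rho> \<partial>lborel) \<le> (\<integral>\<rho>. indicator {0<..h} \<rho> * (c 0 + \<epsilon>) \<partial>lborel)"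
      proof (rule integral_mono)
        show "integrable lborel (\<lambda>\<rho>. indicator {0<..h} \<rho> * c \<rho>)"
          unfolding c_def by (rule integral_U_diff(3)[OF K h(1)])
        show "indicator {0<..h} \<rho> * c \<rho> \<le> indicator {0<..h} \<rho> * (c 0 + \<epsilon>)" for \<rho>
          using \<eta>(2)[of \<rho>] h by (auto simp: indicator_def)
      qed (use h in simp)
      also have "\<dots> = h * (c 0 + \<epsilon>)" using h by simp
      finally have "q t - q r \<le> h * (2 * (c 0 + \<epsilon>))" by (simp add: algebra_simps)
      then have "(q t - q r) / h \<le> 2 * (c 0 + \<epsilon>)" using h by (simp add: field_simps)
      moreover have "(q r - q t) / (r - t) = (q t - q r) / h"
        using h r by (simp add: h_def field_simps)
      ultimately show ?thesis by simp
    qed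
    show ?thesis
    proof (rule tendsto_upperbound[OF q'])
      have "\<forall>\<^sub>F r in at_left t. r \<in> {max 0 (t - \<eta>)<..<t}"
        using t \<eta> by (intro eventually_at_left_real) auto
      then have "\<forall>\<^sub>F r in at_left t. (q r - q t) / (r - t) \<le> 2 * (c 0 + \<epsilon>)"
        by eventually_elim (intro step, auto)
      then show "\<forall>\<^sub>F r in at t within {0..t}. (q r - q t) / (r - t) \<le> 2 * (c 0 + \<epsilon>)"
        using t at_within_Icc_at_left[of 0 t] by simp
      show "at t within {0..t} \<noteq> bot"
        using t at_within_Icc_at_left[of 0 t] by simp
    qed
  qed
  then have "(exp (- 2 * K * t) * ?\<Phi> t + 2 * K * J t) / 2 \<le> c 0 + \<epsilon>" if "\<epsilon> > 0" for \<epsilon>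
    using that by (simp add: field_simps)
  then have "(exp (- 2 * K * t) * ?\<Phi> t + 2 * K * J t) / 2 \<le> c 0"
    by (rule field_le_epsilon)
  moreover have "c 0 = (\<integral>z. exp (- 2 * K * snd z) * (A z \<bullet> W z) \<partial>lborel)"
    by (simp add: c_def flip: zero_prod_def)
  ultimately show ?thesis by (simp add: Jt)
qed

end

section \<open>The elliptic form and essential suprema\<close>

text \<open>The norm of a matrix is here the Frobenius norm, so Cauchy-Schwarz can be applied row by
  row.\<close>

lemma norm_matrix_vector_mult_le:
  fixes A :: "real^'n^'m::finite" and x :: "real^'n::finite"
  shows "norm (A *v x) \<le> norm A * norm x"
proof -
  have "norm (A *v x) = L2_set (\<lambda>i. norm ((A *v x) $ i)) UNIV" by (simp add: norm_vec_def)
  also have "\<dots> \<le> L2_set (\<lambda>i. norm (A $ i) * norm x) UNIV"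
    by (intro L2_set_mono) (auto simp: matrix_vector_mul_component Cauchy_Schwarz_ineq2)
  also have "\<dots> = norm A * norm x" by (simp add: norm_vec_def[of A] L2_set_left_distrib)
  finally show ?thesis .
qed

lemma borel_measurable_vec_nth [measurable (raw)]:
  fixes f :: "'a \<Rightarrow> 'b::real_normed_vector^'n::finite"
  assumes "f \<in> borel_measurable M"
  shows "(\<lambda>x. f x $ i) \<in> borel_measurable M"
proof -
  have "(\<lambda>v::'b^'n. v $ i) \<in> borel_measurable borel"
    by (intro borel_measurable_continuous_onI continuous_intros)
  from measurable_compose[OF assms this] show ?thesis .
qed

lemma borel_measurable_matrix_vector_mult [measurable (raw)]:
  fixes A :: "'a \<Rightarrow> real^'n^'m::finite" and v :: "'a \<Rightarrow> real^'n::finite"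
  assumes "A \<in> borel_measurable M" "v \<in> borel_measurable M"
  shows "(\<lambda>x. A x *v v x) \<in> borel_measurable M"
  using assms
proof (rule borel_measurable_continuous_Pair)
  show "continuous_on UNIV (\<lambda>p::(real^'n^'m) \<times> (real^'n). fst p *v snd p)"
    unfolding matrix_mult_dot by (intro continuous_intros)
qed

lemma borel_measurable_det:
  fixes A :: "'a \<Rightarrow> real^'n^'n::finite"
  assumes "\<And>i j. (\<lambda>x. A x $ i $ j) \<in> borel_measurable M"
  shows "(\<lambda>x. det (A x)) \<in> borel_measurable M"
  unfolding det_def using assms by (intro borel_measurable_sum borel_measurable_times borel_measurable_prod) auto

lemma matrix_inv_mult_vector:
  fixes A :: "real^'n^'n::finite"
  assumes "det A \<noteq> 0"
  shows "A *v (matrix_inv A *v y) = y"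
proof -
  have "invertible A" using assms by (simp add: invertible_det_nz)
  then have "A ** matrix_inv A = mat 1"
    unfolding invertible_def matrix_inv_def by (metis (mono_tags, lifting) someI_ex)
  then show ?thesis by (simp add: matrix_vector_mul_assoc)
qed

text \<open>On singular matrices \<^const>\<open>matrix_inv\<close> takes one and the same unspecified value,
  so that it is Borel measurable everywhere.\<close>

lemma borel_measurable_matrix_inv_form:
  fixes A :: "'a \<Rightarrow> real^'n^'n::finite" and y :: "'a \<Rightarrow> real^'n"
  assumes [measurable]: "A \<in> borel_measurable M" "y \<in> borel_measurable M"
  shows "(\<lambda>x. y x \<bullet> (matrix_inv (A x) *v y x)) \<in> borel_measurable M"
proof -
  define N :: "real^'n^'n" where "N = (SOME A'. False)"
  have N: "matrix_inv B = N" if "det B = 0" for B :: "real^'n^'n"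
    using that invertible_det_nz[of B] unfolding matrix_inv_def N_def invertible_def by metis
  \<comment> \<open>Cramer's rule: on regular matrices the components are quotients of determinants,
    hence of polynomials in the entries.\<close>
  have c: "matrix_inv B *v v = (\<chi> k. det (\<chi> i j. if j = k then v $ i else B $ i $ j) / det B)"
    if "det B \<noteq> 0" for B :: "real^'n^'n" and v
    using cramer[OF that] matrix_inv_mult_vector[OF that] by blast
  have "(\<lambda>x. y x \<bullet> (matrix_inv (A x) *v y x)) = (\<lambda>x. if det (A x) = 0 then y x \<bullet> (N *v y x)
      else \<Sum>k\<in>UNIV. y x $ k * (det (\<chi> i j. if j = k then y x $ i else A x $ i $ j) / det (A x)))"
    using N c by (auto simp: fun_eq_iff inner_vec_def)
  also have "\<dots> \<in> borel_measurable M"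
  proof -
    have [measurable]: "(\<lambda>x. det (A x)) \<in> borel_measurable M"
      by (rule borel_measurable_det) measurable
    have [measurable]: "(\<lambda>x. det (\<chi> i j. if j = k then y x $ i else A x $ i $ j)) \<in> borel_measurable M" for k
    proof (rule borel_measurable_det)
      fix i j
      show "(\<lambda>x. (\<chi> i j. if j = k then y x $ i else A x $ i $ j) $ i $ j) \<in> borel_measurable M"
        by (cases "j = k") simp_all
    qed
    show ?thesis by measurable
  qed
  finally show ?thesis .
qed

text \<open>Coercivity forces a trivial kernel.\<close>

lemma elliptic_det_nz:
  fixes b :: "real^'n^'n::finite"
  assumes "0 < \<delta>" "\<And>\<xi>. \<xi> \<bullet> (b *v \<xi>) \<ge> \<delta> * (norm \<xi>)\<^sup>2"
  shows "det b \<noteq> 0"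
proof -
  have "x = 0" if "b *v x = 0" for x
    using assms(2)[of x] that assms(1) by (simp add: mult_le_0_iff)
  then have "\<exists>B. B ** b = mat 1"
    by (simp add: matrix_left_invertible_ker)
  then show ?thesis using invertible_det_nz invertible_left_inverse by blast
qed

text \<open>The dissipation 2 y . b y is split: the share \<theta> absorbs the term with
  \<open>F\<close> through positivity of the form at y + c w with b w = F, and the share 1 -
  \<theta> absorbs the drift. The rest goes into the coefficient of v^2.\<close>

lemma parabolic_form_bound:
  fixes b :: "real^'n^'n::finite"
  assumes sym: "transpose b = b" and \<delta>: "0 < \<delta>" and ell: "\<And>\<xi>. \<xi> \<bullet> (b *v \<xi>) \<ge> \<delta> * (norm \<xi>)\<^sup>2"
    and \<beta>: "norm f \<le> \<beta>" "\<bar>l\<bar> \<le> \<beta>" and \<epsilon>: "0 < \<epsilon>"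
  shows "2 * (- (b *v y + F) \<bullet> y + (f \<bullet> y + l * v + g) * v)
    \<le> (1/2 + \<epsilon>) * (F \<bullet> (matrix_inv b *v F)) + \<epsilon> * g\<^sup>2
      + (\<beta>\<^sup>2 * (1 + 2 * \<epsilon>) / (4 * \<epsilon> * \<delta>) + 2 * \<beta> + 1 / \<epsilon>) * v\<^sup>2"
proof -
  define w where "w = matrix_inv b *v F"
  define \<theta> where "\<theta> = 1 / (1 + 2 * \<epsilon>)"
  have \<theta>: "0 < \<theta>" "\<theta> < 1" "1 / (2 * \<theta>) = 1/2 + \<epsilon>" "1 - \<theta> = 2 * \<epsilon> / (1 + 2 * \<epsilon>)"
    using \<epsilon> by (auto simp: \<theta>_def field_simps)
  have bw: "b *v w = F"
    unfolding w_def by (rule matrix_inv_mult_vector[OF elliptic_det_nz[OF \<delta> ell]])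
  \<comment> \<open>Symmetry of \<open>b\<close> makes both mixed terms of the form below equal to F
    . y.\<close>
  have wby: "w \<bullet> (b *v y) = F \<bullet> y"
    by (metis bw dot_lmul_matrix sym transpose_matrix_vector)
  \<comment> \<open>This normalizes the mixed term to 2 F . y, so that \<open>F \<bullet> w\<close>
    receives the coefficient 2 \<theta> c^2 = c = 1/2 + \<epsilon>.\<close>
  define c where "c = 1 / (2 * \<theta>)"
  have c: "2 * \<theta> * c = 1" using \<theta>(1) by (simp add: c_def)
  have "0 \<le> \<delta> * (norm (y + c *\<^sub>R w))\<^sup>2" using \<delta> by simp
  also have "\<dots> \<le> (y + c *\<^sub>R w) \<bullet> (b *v (y + c *\<^sub>R w))" by (rule ell)
  also have "\<dots> = y \<bullet> (b *v y) + 2 * c * (F \<bullet> y) + c\<^sup>2 * (F \<bullet> w)"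
    by (simp add: matrix_vector_right_distrib matrix_vector_mult_scaleR bw inner_add wby
        power2_eq_square inner_commute algebra_simps)
  finally have "0 \<le> (2 * \<theta>) * (y \<bullet> (b *v y) + 2 * c * (F \<bullet> y) + c\<^sup>2 * (F \<bullet> w))"
    using \<theta> by simp
  also have "\<dots> = 2 * \<theta> * (y \<bullet> (b *v y)) + 2 * (2 * \<theta> * c) * (F \<bullet> y) + (2 * \<theta> * c) * c * (F \<bullet> w)"
    by (simp add: algebra_simps power2_eq_square)
  finally have 1: "- 2 * (F \<bullet> y) \<le> 2 * \<theta> * (y \<bullet> (b *v y)) + (1/2 + \<epsilon>) * (F \<bullet> w)"
    using \<theta>(3) unfolding c by (simp add: c_def)
  \<comment> \<open>The dissipation left for the drift, bounded below by ellipticity; it equals 4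
    \<epsilon> \<delta> / (1 + 2 \<epsilon>), the source of the first term in the final
    coefficient.\<close>
  define \<alpha> where "\<alpha> = 2 * (1 - \<theta>) * \<delta>"
  have \<alpha>: "0 < \<alpha>" using \<theta>(1,2) \<delta> by (simp add: \<alpha>_def)
  have fy: "f \<bullet> y * v \<le> \<beta> * norm y * \<bar>v\<bar>"
  proof -
    have "f \<bullet> y * v \<le> \<bar>f \<bullet> y\<bar> * \<bar>v\<bar>" by (metis abs_ge_self abs_mult)
    also have "\<dots> \<le> (norm f * norm y) * \<bar>v\<bar>" by (intro mult_right_mono Cauchy_Schwarz_ineq2) auto
    also have "\<dots> \<le> \<beta> * norm y * \<bar>v\<bar>" using \<beta> by (intro mult_right_mono) auto
    finally show ?thesis .
  qed
  have "0 \<le> (\<alpha> * norm y - \<beta> * \<bar>v\<bar>)\<^sup>2 / \<alpha>" using \<alpha> by simp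
  also have "\<dots> = \<alpha> * (norm y)\<^sup>2 - 2 * (\<beta> * norm y * \<bar>v\<bar>) + \<beta>\<^sup>2 / \<alpha> * v\<^sup>2"
  proof -
    have "(\<alpha> * norm y - \<beta> * \<bar>v\<bar>)\<^sup>2 = \<alpha> * (\<alpha> * (norm y)\<^sup>2 - 2 * (\<beta> * norm y * \<bar>v\<bar>)) + \<beta>\<^sup>2 * v\<^sup>2"
      by (simp add: power2_diff power_mult_distrib algebra_simps power2_eq_square)
    then show ?thesis using \<alpha> by (simp add: add_divide_distrib)
  qed
  finally have 2: "2 * (f \<bullet> y * v) \<le> \<alpha> * (norm y)\<^sup>2 + \<beta>\<^sup>2 / \<alpha> * v\<^sup>2" using fy by simp
  have 3: "\<alpha> * (norm y)\<^sup>2 \<le> 2 * (1 - \<theta>) * (y \<bullet> (b *v y))"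
    using mult_left_mono[OF ell[of y], of "2 * (1 - \<theta>)"] \<theta> by (simp add: \<alpha>_def mult.assoc)
  have 4: "l * v\<^sup>2 \<le> \<beta> * v\<^sup>2" using \<beta> by (intro mult_right_mono) auto
  have "0 \<le> (\<epsilon> * g - v)\<^sup>2 / \<epsilon>" using \<epsilon> by simp
  also have "\<dots> = \<epsilon> * g\<^sup>2 - 2 * (g * v) + 1 / \<epsilon> * v\<^sup>2"
  proof -
    have "(\<epsilon> * g - v)\<^sup>2 = \<epsilon> * (\<epsilon> * g\<^sup>2 - 2 * (g * v)) + v\<^sup>2"
      by (simp add: power2_diff power_mult_distrib algebra_simps power2_eq_square)
    then show ?thesis using \<epsilon> by (simp add: add_divide_distrib)
  qed
  finally have 5: "2 * (g * v) \<le> \<epsilon> * g\<^sup>2 + 1 / \<epsilon> * v\<^sup>2" by simp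
  have 6: "\<beta>\<^sup>2 / \<alpha> = \<beta>\<^sup>2 * (1 + 2 * \<epsilon>) / (4 * \<epsilon> * \<delta>)"
    unfolding \<alpha>_def \<theta>(4) using \<epsilon> \<delta> by (simp add: field_simps)
  have "2 * (- (b *v y + F) \<bullet> y + (f \<bullet> y + l * v + g) * v)
     = - 2 * (y \<bullet> (b *v y)) - 2 * (F \<bullet> y) + 2 * (f \<bullet> y * v) + 2 * (l * v\<^sup>2) + 2 * (g * v)"
    by (simp add: inner_add_left inner_diff_left inner_commute algebra_simps power2_eq_square)
  also have "\<dots> \<le> (1/2 + \<epsilon>) * (F \<bullet> w) + \<epsilon> * g\<^sup>2 + (\<beta>\<^sup>2 / \<alpha> + 2 * \<beta> + 1 / \<epsilon>) * v\<^sup>2"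
    using 1 2 3 4 5 by (simp add: algebra_simps)
  finally show ?thesis unfolding 6 w_def .
qed

text \<open>The strict inequality picks an almost everywhere bound below \<beta> out of the set
  itself, whether or not its infimum is attained.\<close>

lemma esssupQ_less_imp_AE:
  assumes "esssupQ Q h < ereal \<beta>"
  shows "AE z in lborel. z \<in> Q \<longrightarrow> h z \<le> \<beta>"
proof -
  obtain c where c: "AE z in QM. z \<in> Q \<longrightarrow> ereal (h z) \<le> c" "c < ereal \<beta>"
    using assms unfolding esssupQ_def Inf_less_iff by blast
  from c(1) show ?thesis
    unfolding QM_eq_lborel
  proof eventually_elim
    case (elim z)
    then show ?case using c(2) by (auto dest: order_le_less_trans)
  qed
qed

lemma esssupQ_mono:
  assumes "\<And>z. h z \<le> k z"
  shows "esssupQ Q h \<le> esssupQ Q k"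
  unfolding esssupQ_def
proof (rule Inf_superset_mono, rule subsetI, simp only: mem_Collect_eq)
  fix c assume "AE z in QM. z \<in> Q \<longrightarrow> ereal (k z) \<le> c"
  then show "AE z in QM. z \<in> Q \<longrightarrow> ereal (h z) \<le> c"
    by eventually_elim (use assms in \<open>auto intro: order_trans[rotated]\<close>)
qed

section \<open>The energy estimate\<close>

lemma L2Q_measurable:
  assumes "L2Q Q F"
  shows "(\<lambda>z. F (fst z) (snd z)) \<in> borel_measurable borel"
  using assms by (simp add: L2Q_def QM_eq_lborel case_prod_unfold)

lemma L2Q_sq_integrable:
  assumes F: "L2Q Q F" and S: "S \<subseteq> Q" "S \<in> sets borel"
  shows "sq_integrable lborel (\<lambda>z. indicator S z *\<^sub>R F (fst z) (snd z))"
proof -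
  have "set_integrable lborel Q (\<lambda>z. (norm (F (fst z) (snd z)))\<^sup>2)"
    using F by (simp add: L2Q_def QM_eq_lborel case_prod_unfold)
  then have "set_integrable lborel S (\<lambda>z. (norm (F (fst z) (snd z)))\<^sup>2)"
    by (rule set_integrable_subset) (use S in auto)
  then show ?thesis
    using L2Q_measurable[OF F] S(2) by (subst sq_integrable_indicator_iff) auto
qed

text \<open>An essential supremum here can be minus infinity, for instance for empty
  \<open>D\<close>. A natural number above it avoids this case and is a nonnegative bound.\<close>

lemma ereal_less_infty_natE:
  assumes "(x::ereal) < \<infinity>"
  obtains n :: nat where "x < ereal (real n)"
  using assms less_PInf_Ex_of_nat[of x] by auto

text \<open>The pointwise bound \<open>parabolic_form_bound\<close> is integrated with the weight
  and inserted into \<open>energy_inequality\<close>. Hypothesis \<open>KM\<close> says that 2 K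
  pays for both the coefficient of u^2 and \<open>M\<close>.\<close>

lemma solution_energy_bound:
  fixes D :: "(real^'n::finite) set"
  assumes adm: "admissible (T, D, \<delta>, b, f, lam)"
    and ess: "esssupQ (D \<times> {0<..<T}) (\<lambda>(x,t). norm (b x t) + norm (f x t) + \<bar>lam x t\<bar>) < ereal \<beta>"
    and \<epsilon>: "0 < \<epsilon>" and K: "0 \<le> K"
    and KM: "\<beta>\<^sup>2 * (1 + 2 * \<epsilon>) / (4 * \<epsilon> * \<delta>) + 2 * \<beta> + 1 / \<epsilon> + M \<le> 2 * K"
    and F: "L2Q (D \<times> {0<..<T}) F" and F0: "L2Q (D \<times> {0<..<T}) F0"
    and sol: "is_solution T D b f lam F F0 u Du" and t: "t \<in> {0<..T}"
  shows "exp (- 2 * K * t) * (LINT x:D|lborel. (u x t)\<^sup>2)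
      + M * (LINT z:(D \<times> {0<..<t})|QM. (case z of (x, s) \<Rightarrow> exp (- 2 * K * s) * (u x s)\<^sup>2))
      \<le> (1/2 + \<epsilon>) * (LINT z:(D \<times> {0<..<t})|QM. (case z of (x, s) \<Rightarrow>
               exp (- 2 * K * s) * (F x s \<bullet> (matrix_inv (b x s) *v F x s))))
       + \<epsilon> * (LINT z:(D \<times> {0<..<t})|QM. (case z of (x, s) \<Rightarrow>
               exp (- 2 * K * s) * (F0 x s)\<^sup>2))"
proof -
  let ?Q = "D \<times> {0<..<t}"
  let ?b = "\<lambda>z. b (fst z) (snd z)" and ?f = "\<lambda>z. f (fst z) (snd z)" and ?l = "\<lambda>z. lam (fst z) (snd z)"
    and ?F = "\<lambda>z. F (fst z) (snd z)" and ?G = "\<lambda>z. F0 (fst z) (snd z)"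
    and ?u = "\<lambda>z. u (fst z) (snd z)" and ?Du = "\<lambda>z. Du (fst z) (snd z)"
  have \<delta>: "0 < \<delta>" and D: "open D" using adm by (auto simp: admissible_def)
  have uL: "L2Q (D \<times> {0<..<T}) u" and DuL: "L2Q (D \<times> {0<..<T}) Du"
    using sol by (auto simp: is_solution_def)
  have Q: "?Q \<in> sets borel" by (intro borel_open open_Times D) auto
  have QT: "?Q \<subseteq> D \<times> {0<..<T}" using t by auto
  have [measurable]: "?Q \<in> sets borel" by (rule Q)
  have snd_m [measurable]: "snd \<in> borel_measurable (borel :: ((real^'n) \<times> real) measure)"
    by (intro borel_measurable_continuous_onI continuous_intros)
  have [measurable]: "?b \<in> borel_measurable borel" "?f \<in> borel_measurable borel" "?l \<in> borel_measurable borel"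
    using adm by (auto simp: admissible_def QM_eq_lborel case_prod_unfold)
  have [measurable]: "?F \<in> borel_measurable borel" "?G \<in> borel_measurable borel"
    "?u \<in> borel_measurable borel" "?Du \<in> borel_measurable borel"
    using L2Q_measurable F F0 uL DuL by blast+
  note sqF = L2Q_sq_integrable[OF F QT Q] and sqF0 = L2Q_sq_integrable[OF F0 QT Q]
    and squ = L2Q_sq_integrable[OF uL QT Q] and sqDu = L2Q_sq_integrable[OF DuL QT Q]
  have ae_ell: "AE z in lborel. z \<in> ?Q \<longrightarrow> transpose (?b z) = ?b z \<and> (\<forall>\<xi>. \<xi> \<bullet> (?b z *v \<xi>) \<ge> \<delta> * (norm \<xi>)\<^sup>2)"
  proof -
    have "AE z in lborel. z \<in> D \<times> {0<..<T} \<longrightarrow> transpose (?b z) = ?b z \<and> (\<forall>\<xi>. \<xi> \<bullet> (?b z *v \<xi>) \<ge> \<delta> * (norm \<xi>)\<^sup>2)"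
      using adm unfolding admissible_def prod.case QM_eq_lborel by blast
    then show ?thesis by eventually_elim (use QT in auto)
  qed
  have ae_bd: "AE z in lborel. z \<in> ?Q \<longrightarrow> norm (?b z) \<le> \<beta> \<and> norm (?f z) \<le> \<beta> \<and> \<bar>?l z\<bar> \<le> \<beta>"
    using esssupQ_less_imp_AE[OF ess]
  proof eventually_elim
    case (elim z)
    show ?case
    proof
      assume "z \<in> ?Q"
      with elim QT have "norm (?b z) + norm (?f z) + \<bar>?l z\<bar> \<le> \<beta>" by (auto simp: case_prod_unfold)
      then show "norm (?b z) \<le> \<beta> \<and> norm (?f z) \<le> \<beta> \<and> \<bar>?l z\<bar> \<le> \<beta>"
        using norm_ge_zero[of "?b z"] norm_ge_zero[of "?f z"] abs_ge_zero[of "?l z"] by linarith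
    qed
  qed
  \<comment> \<open>This bound makes \<open>I1\<close> integrable and stays out of the final
    constants, which must be controlled by \<open>Pof\<close>.\<close>
  obtain \<gamma> where ae_inv: "AE z in lborel. z \<in> ?Q \<longrightarrow> norm (matrix_inv (?b z)) \<le> \<gamma>"
  proof -
    let ?h = "\<lambda>(x,t). norm (b x t) + norm (matrix_inv (b x t)) + norm (f x t) + \<bar>lam x t\<bar>"
    have "esssupQ (D \<times> {0<..<T}) ?h < \<infinity>" using adm by (simp add: admissible_def)
    then obtain n :: nat where "esssupQ (D \<times> {0<..<T}) ?h < ereal (real n)"
      by (rule ereal_less_infty_natE)
    from esssupQ_less_imp_AE[OF this]
    have "AE z in lborel. z \<in> ?Q \<longrightarrow> norm (matrix_inv (?b z)) \<le> real n"
    proof eventually_elim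
      case (elim z)
      show ?case
      proof
        assume "z \<in> ?Q"
        with elim QT have "norm (?b z) + norm (matrix_inv (?b z)) + norm (?f z) + \<bar>?l z\<bar> \<le> real n"
          by (auto simp: case_prod_unfold)
        then show "norm (matrix_inv (?b z)) \<le> real n"
          using norm_ge_zero[of "?b z"] norm_ge_zero[of "?f z"] abs_ge_zero[of "?l z"] by linarith
      qed
    qed
    with that show thesis by blast
  qed
  define A where "A z = indicator ?Q z *\<^sub>R (- (?b z *v ?Du z + ?F z), ?f z \<bullet> ?Du z + ?l z * ?u z + ?G z)" for z
  have A_sq: "sq_integrable lborel A"
  proof -
    have 1: "sq_integrable lborel (\<lambda>z. indicator ?Q z *\<^sub>R (?b z *v ?Du z))"
    proof (rule sq_integrable_bound[OF sqDu, where C = \<beta>])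
      show "AE z in lborel. norm (indicator ?Q z *\<^sub>R (?b z *v ?Du z)) \<le> \<beta> * norm (indicator ?Q z *\<^sub>R ?Du z)"
        using ae_bd
      proof eventually_elim
        case (elim z)
        have "norm (?b z *v ?Du z) \<le> norm (?b z) * norm (?Du z)" by (rule norm_matrix_vector_mult_le)
        also have "z \<in> ?Q \<Longrightarrow> \<dots> \<le> \<beta> * norm (?Du z)" using elim by (intro mult_right_mono) auto
        finally show ?case by (cases "z \<in> ?Q") auto
      qed
    qed measurable
    have 2: "sq_integrable lborel (\<lambda>z. indicator ?Q z *\<^sub>R (?f z \<bullet> ?Du z))"
    proof (rule sq_integrable_bound[OF sqDu, where C = \<beta>])
      show "AE z in lborel. norm (indicator ?Q z *\<^sub>R (?f z \<bullet> ?Du z)) \<le> \<beta> * norm (indicator ?Q z *\<^sub>R ?Du z)"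
        using ae_bd
      proof eventually_elim
        case (elim z)
        have "norm (?f z \<bullet> ?Du z) \<le> norm (?f z) * norm (?Du z)" using Cauchy_Schwarz_ineq2 by simp
        also have "z \<in> ?Q \<Longrightarrow> \<dots> \<le> \<beta> * norm (?Du z)" using elim by (intro mult_right_mono) auto
        finally show ?case by (cases "z \<in> ?Q") auto
      qed
    qed measurable
    have 3: "sq_integrable lborel (\<lambda>z. indicator ?Q z *\<^sub>R (?l z * ?u z))"
    proof (rule sq_integrable_bound[OF squ, where C = \<beta>])
      show "AE z in lborel. norm (indicator ?Q z *\<^sub>R (?l z * ?u z)) \<le> \<beta> * norm (indicator ?Q z *\<^sub>R ?u z)"
        using ae_bd
        by eventually_elim (auto simp: indicator_def abs_mult intro!: mult_right_mono)
    qed measurable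
    have "A = (\<lambda>z. (- (indicator ?Q z *\<^sub>R (?b z *v ?Du z) + indicator ?Q z *\<^sub>R ?F z),
        indicator ?Q z *\<^sub>R (?f z \<bullet> ?Du z) + indicator ?Q z *\<^sub>R (?l z * ?u z) + indicator ?Q z *\<^sub>R ?G z))"
      by (auto simp: A_def fun_eq_iff indicator_def zero_prod_def)
    then show ?thesis
      using sq_integrable_Pair[OF sq_integrable_minus[OF sq_integrable_add[OF 1 sqF]]
          sq_integrable_add[OF sq_integrable_add[OF 2 3] sqF0]] by simp
  qed
  interpret weak_evolution D t u Du A
  proof
    show "0 < t" using t by simp
    show "open D" by (rule D)
    show "sq_integrable lborel (\<lambda>z. indicator ?Q z *\<^sub>R (?Du z, ?u z))"
      using sq_integrable_Pair[OF sqDu squ] by simp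
    show "sq_integrable lborel A" by (rule A_sq)
    show "A z = 0" if "z \<notin> ?Q" for z using that by (simp add: A_def zero_prod_def)
    have "AE s in lborel. s \<in> {0<..<T} \<longrightarrow> H10 D (\<lambda>x. u x s) (\<lambda>x. Du x s)"
      using sol by (simp add: is_solution_def)
    then show "AE s in lborel. s \<in> {0<..<t} \<longrightarrow> H10 D (\<lambda>x. u x s) (\<lambda>x. Du x s)"
      by eventually_elim (use t in auto)
    show "set_integrable lborel D (\<lambda>x. (u x s)\<^sup>2)" if "s \<in> {0..t}" for s
      using sol that t by (auto simp: is_solution_def)
    show "((\<lambda>r. LINT x:D|lborel. (u x r - u x s)\<^sup>2) \<longlongrightarrow> 0) (at s within {0..t})" if "s \<in> {0..t}" for s
    proof (rule tendsto_within_subset)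
      show "((\<lambda>r. LINT x:D|lborel. (u x r - u x s)\<^sup>2) \<longlongrightarrow> 0) (at s within {0..T})"
        using sol that t by (auto simp: is_solution_def)
    qed (use t in auto)
    show "(LINT x:D|lborel. u x s * \<psi> x)
        = (\<integral>z. indicator {..<s} (snd z) * (A z \<bullet> (grad \<psi> (fst z), \<psi> (fst z))) \<partial>lborel)"
      if s: "s \<in> {0..t}" and \<psi>: "testfun D \<psi>" for s \<psi>
    proof -
      have "s \<in> {0..T}" using s t by auto
      with sol \<psi> have "(LINT x:D|lborel. u x s * \<psi> x) =
        (LINT z:(D \<times> {0<..<s})|QM. (case z of (x, s) \<Rightarrow>
            - ((b x s *v Du x s) \<bullet> grad \<psi> x)
            + (f x s \<bullet> Du x s + lam x s * u x s) * \<psi> x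
            - F x s \<bullet> grad \<psi> x + F0 x s * \<psi> x))"
        unfolding is_solution_def by blast
      also have "\<dots> = (\<integral>z. indicator {..<s} (snd z) * (A z \<bullet> (grad \<psi> (fst z), \<psi> (fst z))) \<partial>lborel)"
        unfolding set_lebesgue_integral_def QM_eq_lborel
        using s by (intro Bochner_Integration.integral_cong)
          (auto simp: A_def indicator_def inner_add_left inner_diff_left algebra_simps)
      finally show ?thesis .
    qed
  qed measurable
  let ?e = "\<lambda>z::(real^'n) \<times> real. exp (- 2 * K * snd z)"
  let ?\<kappa> = "\<beta>\<^sup>2 * (1 + 2 * \<epsilon>) / (4 * \<epsilon> * \<delta>) + 2 * \<beta> + 1 / \<epsilon>"
  define I1 where "I1 z = indicator ?Q z *\<^sub>R (?e z * (?F z \<bullet> (matrix_inv (?b z) *v ?F z)))" for z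
  define I0 where "I0 z = indicator ?Q z *\<^sub>R (?e z * (?G z)\<^sup>2)" for z
  define Iu where "Iu z = indicator ?Q z *\<^sub>R (?e z * (?u z)\<^sup>2)" for z
  have e_le: "?e z \<le> 1" if "z \<in> ?Q" for z using that K by (auto simp: mult_nonneg_nonneg)
  have Iu_eq: "?e z * (U z)\<^sup>2 = Iu z" for z
    by (auto simp: U_eq Iu_def indicator_def)
  have Iu_i: "integrable lborel Iu"
    using integrable_weighted_U_square[OF K] unfolding Iu_eq .
  have I0_i: "integrable lborel I0"
  proof (rule Bochner_Integration.integrable_bound)
    show "integrable lborel (\<lambda>z. (norm (indicator ?Q z *\<^sub>R ?G z))\<^sup>2)"
      using sqF0 by (simp add: sq_integrable_def)
    show "I0 \<in> borel_measurable lborel" unfolding I0_def[abs_def] by measurable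
    show "AE z in lborel. norm (I0 z) \<le> norm ((norm (indicator ?Q z *\<^sub>R ?G z))\<^sup>2)"
    proof (rule AE_I2)
      fix z
      have "z \<in> ?Q \<Longrightarrow> ?e z * (?G z)\<^sup>2 \<le> 1 * (?G z)\<^sup>2"
        by (intro mult_right_mono e_le) auto
      then show "norm (I0 z) \<le> norm ((norm (indicator ?Q z *\<^sub>R ?G z))\<^sup>2)"
        by (cases "z \<in> ?Q") (auto simp: I0_def)
    qed
  qed
  have I1_i: "integrable lborel I1"
  proof (rule Bochner_Integration.integrable_bound)
    show "integrable lborel (\<lambda>z. \<gamma> * (norm (indicator ?Q z *\<^sub>R ?F z))\<^sup>2)"
      using sqF by (simp add: sq_integrable_def)
    have [measurable]: "(\<lambda>z. ?F z \<bullet> (matrix_inv (?b z) *v ?F z)) \<in> borel_measurable borel"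
      by (rule borel_measurable_matrix_inv_form) measurable
    show "I1 \<in> borel_measurable lborel" unfolding I1_def[abs_def] by measurable
    show "AE z in lborel. norm (I1 z) \<le> norm (\<gamma> * (norm (indicator ?Q z *\<^sub>R ?F z))\<^sup>2)"
      using ae_inv
    proof eventually_elim
      case (elim z)
      show ?case
      proof (cases "z \<in> ?Q")
        case True
        let ?v = "\<bar>?F z \<bullet> (matrix_inv (?b z) *v ?F z)\<bar>"
        have "?e z * ?v \<le> 1 * ?v" by (intro mult_right_mono e_le True) auto
        also have "?v \<le> norm (?F z) * norm (matrix_inv (?b z) *v ?F z)" by (rule Cauchy_Schwarz_ineq2)
        also have "\<dots> \<le> norm (?F z) * (\<gamma> * norm (?F z))"
        proof (intro mult_left_mono)
          have "norm (matrix_inv (?b z) *v ?F z) \<le> norm (matrix_inv (?b z)) * norm (?F z)"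
            by (rule norm_matrix_vector_mult_le)
          also have "\<dots> \<le> \<gamma> * norm (?F z)" using elim True by (intro mult_right_mono) auto
          finally show "norm (matrix_inv (?b z) *v ?F z) \<le> \<gamma> * norm (?F z)" .
        qed auto
        finally have "?e z * ?v \<le> \<gamma> * (norm (?F z))\<^sup>2" by (simp add: power2_eq_square algebra_simps)
        then show ?thesis
          using True abs_ge_self[of "\<gamma> * (norm (?F z))\<^sup>2"] by (auto simp: I1_def abs_mult)
      qed (simp add: I1_def)
    qed
  qed
  have AW_i: "integrable lborel (\<lambda>z. ?e z * (A z \<bullet> W z))"
    using integrable_inner_sq[OF A_sq integral_U_diff(1)[OF K zero_less_one]] by simp
  have "2 * (\<integral>z. ?e z * (A z \<bullet> W z) \<partial>lborel) = (\<integral>z. 2 * (?e z * (A z \<bullet> W z)) \<partial>lborel)" by simp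
  also have "\<dots> \<le> (\<integral>z. (1/2 + \<epsilon>) * I1 z + \<epsilon> * I0 z + ?\<kappa> * Iu z \<partial>lborel)"
  proof (rule integral_mono_AE)
    show "integrable lborel (\<lambda>z. 2 * (?e z * (A z \<bullet> W z)))" using AW_i by simp
    show "integrable lborel (\<lambda>z. (1/2 + \<epsilon>) * I1 z + \<epsilon> * I0 z + ?\<kappa> * Iu z)"
      by (intro Bochner_Integration.integrable_add integrable_mult_right I1_i I0_i Iu_i)
    show "AE z in lborel. 2 * (?e z * (A z \<bullet> W z)) \<le> (1/2 + \<epsilon>) * I1 z + \<epsilon> * I0 z + ?\<kappa> * Iu z"
      using ae_ell ae_bd
    proof eventually_elim
      case (elim z)
      show ?case
      proof (cases "z \<in> ?Q")
        case True
        have "2 * (- (?b z *v ?Du z + ?F z) \<bullet> ?Du z + (?f z \<bullet> ?Du z + ?l z * ?u z + ?G z) * ?u z)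
          \<le> (1/2 + \<epsilon>) * (?F z \<bullet> (matrix_inv (?b z) *v ?F z)) + \<epsilon> * (?G z)\<^sup>2 + ?\<kappa> * (?u z)\<^sup>2"
          using elim True by (intro parabolic_form_bound \<delta> \<epsilon>) auto
        from mult_left_mono[OF this, of "?e z"]
        show ?thesis
          using True by (simp add: A_def W_def I1_def I0_def Iu_def algebra_simps)
      qed (simp add: I1_def I0_def Iu_def W_zero)
    qed
  qed
  also have "\<dots> = (1/2 + \<epsilon>) * (\<integral>z. I1 z \<partial>lborel) + \<epsilon> * (\<integral>z. I0 z \<partial>lborel) + ?\<kappa> * (\<integral>z. Iu z \<partial>lborel)"
    using I1_i I0_i Iu_i by simp
  finally have "exp (- 2 * K * t) * (LINT x:D|lborel. (u x t)\<^sup>2) + 2 * K * (\<integral>z. Iu z \<partial>lborel)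
     \<le> (1/2 + \<epsilon>) * (\<integral>z. I1 z \<partial>lborel) + \<epsilon> * (\<integral>z. I0 z \<partial>lborel) + ?\<kappa> * (\<integral>z. Iu z \<partial>lborel)"
    using energy_inequality[OF K] unfolding Iu_eq by linarith
  \<comment> \<open>What remains of 2 K after absorbing the u^2 term is at least \<open>M\<close>,
    and the integral of \<open>Iu\<close> is nonnegative.\<close>
  moreover have "(?\<kappa> + M) * (\<integral>z. Iu z \<partial>lborel) \<le> 2 * K * (\<integral>z. Iu z \<partial>lborel)"
    by (intro mult_right_mono KM integral_nonneg_AE) (auto simp: Iu_def)
  ultimately have "exp (- 2 * K * t) * (LINT x:D|lborel. (u x t)\<^sup>2) + M * (\<integral>z. Iu z \<partial>lborel)
     \<le> (1/2 + \<epsilon>) * (\<integral>z. I1 z \<partial>lborel) + \<epsilon> * (\<integral>z. I0 z \<partial>lborel)"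
    unfolding distrib_right by linarith
  then show ?thesis
    by (simp add: set_lebesgue_integral_def QM_eq_lborel case_prod_unfold I1_def I0_def Iu_def)
qed

text \<open>The chosen \<open>K\<close> sees the data only through \<delta> and a bound for the
  essential supremum in \<open>Pof\<close>, so the estimate transfers to every other admissible
  datum with the same \<open>Pof\<close>.\<close>

lemma ex_energy_ok:
  fixes \<mu> :: "('n::finite) data"
  assumes adm: "admissible \<mu>" and M: "0 \<le> M" and \<epsilon>: "0 < \<epsilon>"
  shows "\<exists>K\<ge>0. energy_ok K M (Pof \<mu>) (1/2 + \<epsilon>) \<epsilon>"
proof -
  obtain T D \<delta> b f lam where \<mu>: "\<mu> = (T, D, \<delta>, b, f, lam)" by (cases \<mu>) auto
  define E where "E = esssupQ (D \<times> {0<..<T}) (\<lambda>(x,t). norm (b x t) + norm (f x t) + \<bar>lam x t\<bar>)"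
  have "E \<le> esssupQ (D \<times> {0<..<T}) (\<lambda>(x,t). norm (b x t) + norm (matrix_inv (b x t)) + norm (f x t) + \<bar>lam x t\<bar>)"
    unfolding E_def by (rule esssupQ_mono) auto
  also have "\<dots> < \<infinity>" using adm by (simp add: \<mu> admissible_def)
  finally obtain n :: nat where n: "E < ereal (real n)" by (rule ereal_less_infty_natE)
  define \<beta> where "\<beta> = real n"
  have \<delta>: "0 < \<delta>" using adm by (simp add: \<mu> admissible_def)
  \<comment> \<open>The smallest \<open>K\<close> allowed by the hypothesis \<open>KM\<close> of
    \<open>solution_energy_bound\<close>.\<close>
  define K where "K = (\<beta>\<^sup>2 * (1 + 2 * \<epsilon>) / (4 * \<epsilon> * \<delta>) + 2 * \<beta> + 1 / \<epsilon> + M) / 2"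
  have K: "0 \<le> K" using \<epsilon> \<delta> M by (auto simp: K_def \<beta>_def intro!: add_nonneg_nonneg divide_nonneg_nonneg)
  have "energy_ok K M (Pof \<mu>) (1/2 + \<epsilon>) \<epsilon>"
    unfolding energy_ok_def
  proof (intro allI impI, elim conjE)
    fix \<mu>' :: "'n data" assume adm': "admissible \<mu>'" and P: "Pof \<mu>' = Pof \<mu>"
    obtain T' D' \<delta>' b' f' lam' where \<mu>': "\<mu>' = (T', D', \<delta>', b', f', lam')" by (cases \<mu>') auto
    have e: "T' = T" "D' = D" "\<delta>' = \<delta>"
      "esssupQ (D \<times> {0<..<T}) (\<lambda>(x,t). norm (b' x t) + norm (f' x t) + \<bar>lam' x t\<bar>) = E"
      using P by (auto simp: \<mu> \<mu>' Pof_def E_def)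
    show "case \<mu>' of (T, D, \<delta>, b, f, lam) \<Rightarrow>
         \<forall>F F0 u Du. L2Q (D \<times> {0<..<T}) F \<and> L2Q (D \<times> {0<..<T}) F0 \<and>
           is_solution T D b f lam F F0 u Du \<longrightarrow>
           (\<forall>t\<in>{0<..T}.
              exp (- 2 * K * t) * (LINT x:D|lborel. (u x t)\<^sup>2)
              + M * (LINT z:(D \<times> {0<..<t})|QM. (case z of (x, s) \<Rightarrow> exp (- 2 * K * s) * (u x s)\<^sup>2))
              \<le> (1/2 + \<epsilon>) * (LINT z:(D \<times> {0<..<t})|QM. (case z of (x, s) \<Rightarrow>
                       exp (- 2 * K * s) * (F x s \<bullet> (matrix_inv (b x s) *v F x s))))
               + \<epsilon> * (LINT z:(D \<times> {0<..<t})|QM. (case z of (x, s) \<Rightarrow>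
                       exp (- 2 * K * s) * (F0 x s)\<^sup>2)))"
      unfolding \<mu>' e prod.case
    proof (intro allI impI ballI, elim conjE)
      fix F F0 u Du t
      assume "L2Q (D \<times> {0<..<T}) F" "L2Q (D \<times> {0<..<T}) F0" "is_solution T D b' f' lam' F F0 u Du" "t \<in> {0<..T}"
      then show "exp (- 2 * K * t) * (LINT x:D|lborel. (u x t)\<^sup>2)
              + M * (LINT z:(D \<times> {0<..<t})|QM. (case z of (x, s) \<Rightarrow> exp (- 2 * K * s) * (u x s)\<^sup>2))
              \<le> (1/2 + \<epsilon>) * (LINT z:(D \<times> {0<..<t})|QM. (case z of (x, s) \<Rightarrow>
                       exp (- 2 * K * s) * (F x s \<bullet> (matrix_inv (b' x s) *v F x s))))
               + \<epsilon> * (LINT z:(D \<times> {0<..<t})|QM. (case z of (x, s) \<Rightarrow>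
                       exp (- 2 * K * s) * (F0 x s)\<^sup>2))"
        using adm' n unfolding \<mu>' e
        by (intro solution_energy_bound[where \<beta> = \<beta> and \<delta> = \<delta> and lam = lam' and f = f'] \<epsilon> K)
          (auto simp: e \<beta>_def K_def)
    qed
  qed
  with K show ?thesis by blast
qed

section \<open>Test functions\<close>

text \<open>The flat function exp(-1/s); the polynomial in 1/s makes the family closed under
  differentiation.\<close>

definition exp_inv :: "real poly \<Rightarrow> real \<Rightarrow> real" where
  "exp_inv p s = (if s > 0 then poly p (1 / s) * exp (- 1 / s) else 0)"

text \<open>With y = 1/s one has d/ds = - y^2 d/dy, and this turns p(y) exp(-y) into y^2 (p - p')(y)
  exp(-y).\<close>

definition exp_inv_deriv :: "real poly \<Rightarrow> real poly" where
  "exp_inv_deriv p = monom 1 2 * (p - pderiv p)"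

lemma poly_div_exp_tendsto_0: "((\<lambda>y. poly p y / exp y) \<longlongrightarrow> (0::real)) at_top"
proof -
  have "((\<lambda>y. \<Sum>i\<le>degree p. coeff p i * (y ^ i / exp y)) \<longlongrightarrow> (\<Sum>i\<le>degree p. coeff p i * 0)) at_top"
    by (intro tendsto_intros tendsto_power_div_exp_0)
  then show ?thesis by (simp add: poly_altdef sum_divide_distrib)
qed

lemma exp_inv_has_derivative:
  "(exp_inv p has_real_derivative exp_inv (exp_inv_deriv p) s) (at s)"
proof -
  consider "s > 0" | "s < 0" | "s = 0" by linarith
  then show ?thesis
  proof cases
    case 1
    have "((\<lambda>s. poly p (1 / s) * exp (- 1 / s)) has_real_derivative
        poly (exp_inv_deriv p) (1 / s) * exp (- 1 / s)) (at s)"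
      using 1 by (auto intro!: derivative_eq_intros simp: exp_inv_deriv_def poly_monom field_simps power2_eq_square)
    moreover have "\<forall>\<^sub>F r in nhds s. poly p (1 / r) * exp (- 1 / r) = exp_inv p r"
      using eventually_nhds_in_open[of "{0<..}" s] 1 by (auto elim!: eventually_mono simp: exp_inv_def)
    ultimately show ?thesis
      using 1 DERIV_cong_ev[of s s "\<lambda>s. poly p (1 / s) * exp (- 1 / s)" "exp_inv p"]
      by (simp add: exp_inv_def)
  next
    case 2
    have "\<forall>\<^sub>F r in nhds s. 0 = exp_inv p r"
      using eventually_nhds_in_open[of "{..<0}" s] 2 by (auto elim!: eventually_mono simp: exp_inv_def)
    then show ?thesis
      using 2 DERIV_cong_ev[of s s "\<lambda>_. 0" "exp_inv p" 0 0] by (simp add: exp_inv_def)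
  next
    case 3
    \<comment> \<open>The right difference quotient at 0 becomes y p(y) / exp y under y = 1/s, and
      exponential decay wins.\<close>
    have "((\<lambda>y. poly (monom 1 1 * p) y / exp y) \<longlongrightarrow> 0) at_top"
      by (rule poly_div_exp_tendsto_0)
    from filterlim_compose[OF this filterlim_inverse_at_top_right]
    have "((\<lambda>s. poly (monom 1 1 * p) (inverse s) / exp (inverse s)) \<longlongrightarrow> 0) (at_right 0)" .
    then have R: "((\<lambda>s. exp_inv p s / s) \<longlongrightarrow> 0) (at_right 0)"
    proof (rule Lim_transform_eventually)
      show "\<forall>\<^sub>F s in at_right 0. poly (monom 1 1 * p) (inverse s) / exp (inverse s) = exp_inv p s / s"
        by (auto simp: eventually_at_filter exp_inv_def poly_monom exp_minus field_simps)
    qed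
    have L: "((\<lambda>s. exp_inv p s / s) \<longlongrightarrow> 0) (at_left 0)"
      by (rule tendsto_eventually) (auto simp: eventually_at_filter exp_inv_def)
    show ?thesis
      unfolding 3 has_field_derivative_iff using L R
      by (simp add: exp_inv_def filterlim_split_at)
  qed
qed

text \<open>The functions \<open>\<Sum> p(1/s) exp(-1/s) q(1/(1-s)) exp(-1/(1-s))\<close>, extended by zero, form a class
  closed under differentiation, so all derivatives of the bump are available in closed form.\<close>

definition bump_sum :: "(real poly \<times> real poly) list \<Rightarrow> real \<Rightarrow> real" where
  "bump_sum L s = (\<Sum>(p, q)\<leftarrow>L. exp_inv p s * exp_inv q (1 - s))"

text \<open>The product rule on each summand; the minus sign is the inner derivative of 1 -
  s.\<close>

fun bump_sum_deriv :: "(real poly \<times> real poly) list \<Rightarrow> (real poly \<times> real poly) list" where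
  "bump_sum_deriv [] = []"
| "bump_sum_deriv ((p, q) # L) = (exp_inv_deriv p, q) # (p, - exp_inv_deriv q) # bump_sum_deriv L"

lemma bump_sum_has_derivative:
  "(bump_sum L has_real_derivative bump_sum (bump_sum_deriv L) s) (at s)"
proof (induction L rule: bump_sum_deriv.induct)
  case 1
  then show ?case by (simp add: bump_sum_def[abs_def])
next
  case (2 p q L)
  have m: "exp_inv (- r) x = - exp_inv r x" for r x by (simp add: exp_inv_def)
  have "((\<lambda>s. exp_inv q (1 - s)) has_real_derivative exp_inv (exp_inv_deriv q) (1 - s) * (- 1)) (at s)"
    by (rule DERIV_chain2[OF exp_inv_has_derivative]) (auto intro!: derivative_eq_intros)
  from DERIV_add[OF DERIV_mult[OF exp_inv_has_derivative[of p s] this] 2]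
  show ?case by (simp add: bump_sum_def[abs_def] m algebra_simps)
qed

text \<open>The \<open>k\<close>-th derivative of the bump exp(-1/s - 1/(1-s)) on (0, 1), the pair
  \<open>(1, 1)\<close> being constant polynomials.\<close>

definition bump1 :: "nat \<Rightarrow> real \<Rightarrow> real" where
  "bump1 k = bump_sum ((bump_sum_deriv ^^ k) [(1, 1)])"

lemma bump1_has_derivative: "(bump1 k has_real_derivative bump1 (Suc k) s) (at s)"
  unfolding bump1_def by (simp add: bump_sum_has_derivative)

lemma bump1_continuous: "continuous_on UNIV (bump1 k)"
  by (meson DERIV_isCont bump1_has_derivative continuous_at_imp_continuous_on)

lemma bump1_zero: "bump1 0 s = 0" if "s \<le> 0 \<or> 1 \<le> s"
  using that by (auto simp: bump1_def bump_sum_def exp_inv_def)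

lemma bump1_half: "bump1 0 (1/2) > 0"
  by (simp add: bump1_def bump_sum_def exp_inv_def)

definition bump :: "real^'n::finite \<Rightarrow> real" where
  "bump x = (\<Prod>i\<in>UNIV. bump1 0 (x $ i))"

text \<open>Here \<open>c\<close> acts as a multi-index: along axis \<open>j\<close> only the
  \<open>j\<close>-th factor varies, and its order goes up by one.\<close>

lemma bump_prod_has_derivative:
  fixes x :: "real^'n::finite" and c :: "'n \<Rightarrow> nat"
  shows "((\<lambda>s. \<Prod>i\<in>UNIV. bump1 (c i) ((x + s *\<^sub>R axis j 1) $ i)) has_real_derivative
    (\<Prod>i\<in>UNIV. bump1 ((if i = j then Suc (c i) else c i)) (x $ i))) (at 0)"
proof -
  have s: "(\<Prod>i\<in>UNIV. g i) = g j * (\<Prod>i\<in>UNIV - {j}. g i)" for g :: "'n \<Rightarrow> real"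
    by (intro prod.remove) auto
  have "((\<lambda>s. bump1 (c j) (x $ j + s)) has_real_derivative bump1 (Suc (c j)) (x $ j + 0) * 1) (at 0)"
    by (rule DERIV_chain2[OF bump1_has_derivative]) (auto intro!: derivative_eq_intros)
  from DERIV_cmult_right[OF this, of "\<Prod>i\<in>UNIV - {j}. bump1 (c i) (x $ i)"]
  have d: "((\<lambda>s. bump1 (c j) (x $ j + s) * (\<Prod>i\<in>UNIV - {j}. bump1 (c i) (x $ i))) has_real_derivative
     bump1 (Suc (c j)) (x $ j) * (\<Prod>i\<in>UNIV - {j}. bump1 (c i) (x $ i))) (at 0)" by simp
  have 1: "(\<Prod>i\<in>UNIV. bump1 (c i) ((x + s *\<^sub>R axis j 1) $ i)) = bump1 (c j) (x $ j + s) * (\<Prod>i\<in>UNIV - {j}. bump1 (c i) (x $ i))" for s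
    unfolding s[of "\<lambda>i. bump1 (c i) ((x + s *\<^sub>R axis j 1) $ i)"]
    by (intro arg_cong2[where f = "(*)"] prod.cong) (auto simp: axis_def)
  have 2: "(\<Prod>i\<in>UNIV. bump1 ((if i = j then Suc (c i) else c i)) (x $ i))
      = bump1 (Suc (c j)) (x $ j) * (\<Prod>i\<in>UNIV - {j}. bump1 (c i) (x $ i))"
    unfolding s[of "\<lambda>i. bump1 ((if i = j then Suc (c i) else c i)) (x $ i)"]
    by (intro arg_cong2[where f = "(*)"] prod.cong) auto
  show ?thesis unfolding 1 2 by (rule d)
qed

text \<open>How often each axis occurs in \<open>js\<close> is all that survives of the list.
  Smoothness of the bump can be read off this closed form.\<close>

lemma pd_bump:
  fixes js :: "'n::finite list"
  shows "pd js bump = (\<lambda>x. \<Prod>i\<in>UNIV. bump1 (count_list js i) (x $ i))"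
proof (induction js)
  case Nil
  then show ?case by (simp add: bump_def[abs_def])
next
  case (Cons j js)
  show ?case
  proof
    fix x
    have "pd (j # js) bump x = (\<Prod>i\<in>UNIV. bump1 (if i = j then Suc (count_list js i) else count_list js i) (x $ i))"
      using DERIV_imp_deriv[OF bump_prod_has_derivative[of "count_list js" x j]] by (simp add: Cons.IH)
    also have "\<dots> = (\<Prod>i\<in>UNIV. bump1 (count_list (j # js) i) (x $ i))"
      by (intro prod.cong) auto
    finally show "pd (j # js) bump x = \<dots>" .
  qed
qed

lemma testfun_bump: "testfun UNIV (bump :: real^'n::finite \<Rightarrow> real)"
  unfolding testfun_def
proof (intro conjI exI)
  show "smooth_fun (bump :: real^'n \<Rightarrow> real)"
    unfolding smooth_fun_def pd_bump
  proof (intro allI conjI)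
    fix js :: "'n list" and x :: "real^'n" and j :: 'n
    show "continuous_on UNIV (\<lambda>x::real^'n. \<Prod>i\<in>UNIV. bump1 (count_list js i) (x $ i))"
      by (intro continuous_intros continuous_on_compose2[OF bump1_continuous]) auto
    show "(\<lambda>s. \<Prod>i\<in>UNIV. bump1 (count_list js i) ((x + s *\<^sub>R axis j 1) $ i)) differentiable at 0"
      using bump_prod_has_derivative real_differentiable_def by blast
  qed
  show "compact (cbox (0::real^'n) 1)" by simp
  show "\<forall>x::real^'n. x \<notin> cbox 0 1 \<longrightarrow> bump x = 0"
  proof (intro allI impI)
    fix x :: "real^'n" assume "x \<notin> cbox 0 1"
    then obtain i where "\<not> (0 \<le> x $ i \<and> x $ i \<le> 1)" by (auto simp: mem_box_cart)
    then have "x $ i \<le> 0 \<or> 1 \<le> x $ i" by linarith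
    then have "bump1 0 (x $ i) = 0" by (rule bump1_zero)
    then show "bump x = 0" unfolding bump_def by (metis finite UNIV_I prod_zero)
  qed
qed simp

lemma bump_nonzero: "bump (\<chi> i. 1/2 :: real^'n::finite) \<noteq> 0"
  using bump1_half by (simp add: bump_def)

section \<open>Derivatives of test functions and integration by parts\<close>

lemma pd_append: "pd (is @ js) g = pd is (pd js g)"
  by (induction "is") simp_all

lemma smooth_fun_pd: "smooth_fun g \<Longrightarrow> smooth_fun (pd js g)"
  unfolding smooth_fun_def pd_append[symmetric] by blast

lemma smooth_fun_has_derivative:
  assumes "smooth_fun g"
  shows "((\<lambda>s. pd js g (x + s *\<^sub>R axis i 1)) has_real_derivative pd (i # js) g x) (at 0)"
  using assms DERIV_deriv_iff_real_differentiable unfolding smooth_fun_def by fastforce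

lemma testfun_pd:
  assumes "testfun D g"
  shows "testfun D (pd [i] g)"
proof -
  obtain C where C: "compact C" "C \<subseteq> D" "\<And>x. x \<notin> C \<Longrightarrow> grad g x = 0"
    using testfun_support[OF assms] by metis
  have "pd [i] g x = 0" if "x \<notin> C" for x
    using arg_cong[OF C(3)[OF that], of "\<lambda>v. v $ i"] by (simp add: grad_def)
  with C show ?thesis
    using assms smooth_fun_pd[of g "[i]"] unfolding testfun_def by blast
qed

lemma pd_cmult:
  assumes "smooth_fun g"
  shows "pd js (\<lambda>x. c * g x) = (\<lambda>x. c * pd js g x)"
proof (induction js)
  case (Cons i js)
  show ?case
    using DERIV_imp_deriv[OF DERIV_cmult[OF smooth_fun_has_derivative[OF assms]]]
    by (simp add: Cons.IH fun_eq_iff)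
qed simp

lemma testfun_cmult:
  assumes g: "testfun D g"
  shows "testfun D (\<lambda>x. c * g x)"
proof -
  have s: "smooth_fun g" using g by (simp add: testfun_def)
  have "smooth_fun (\<lambda>x. c * g x)"
    unfolding smooth_fun_def pd_cmult[OF s]
  proof (intro allI conjI)
    fix js x i
    show "continuous_on UNIV (\<lambda>x. c * pd js g x)"
      using s unfolding smooth_fun_def by (intro continuous_intros) blast
    show "(\<lambda>t. c * pd js g (x + t *\<^sub>R axis i 1)) differentiable at 0"
      using DERIV_cmult[OF smooth_fun_has_derivative[OF s]] real_differentiable_def by blast
  qed
  with g show ?thesis unfolding testfun_def by (metis mult_zero_right)
qed

lemma grad_cmult: "smooth_fun g \<Longrightarrow> grad (\<lambda>x. c * g x) x = c *\<^sub>R grad g x"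
  by (simp only: grad_def pd_cmult) (simp add: vec_eq_iff)

text \<open>By translation invariance every difference quotient has integral zero. Dominated
  convergence carries this over to the derivative; the mean value theorem bounds the quotients by
  the maximum of |g'| on a fixed compact set.\<close>

lemma integral_directional_derivative_zero:
  fixes g g' :: "'a::euclidean_space \<Rightarrow> real"
  assumes g: "continuous_on UNIV g" and g': "continuous_on UNIV g'"
    and C: "compact C" "\<And>x. x \<notin> C \<Longrightarrow> g x = 0" "\<And>x. x \<notin> C \<Longrightarrow> g' x = 0"
    and d: "\<And>x. ((\<lambda>s. g (x + s *\<^sub>R e)) has_real_derivative g' x) (at 0)"
  shows "(\<integral>x. g' x \<partial>lborel) = 0"
proof -
  have gi: "integrable lborel g"
  proof -
    have "integrable lborel (\<lambda>x. indicator C x *\<^sub>R g x)"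
      using C g by (intro borel_integrable_compact continuous_on_subset[OF g]) auto
    also have "(\<lambda>x. indicator C x *\<^sub>R g x) = g" using C by (auto simp: fun_eq_iff indicator_def)
    finally show ?thesis .
  qed
  have [measurable]: "g \<in> borel_measurable borel" "g' \<in> borel_measurable borel"
    using g g' by (auto intro: borel_measurable_continuous_onI)
  have d': "((\<lambda>s. g (x + s *\<^sub>R e)) has_real_derivative g' (x + s *\<^sub>R e)) (at s)" for x s
  proof -
    have "((\<lambda>r. g (x + s *\<^sub>R e + r *\<^sub>R e)) has_real_derivative g' (x + s *\<^sub>R e)) (at 0)" by (rule d)
    then have "((\<lambda>r. g (x + (r + s) *\<^sub>R e)) has_real_derivative g' (x + s *\<^sub>R e)) (at 0)"
      by (simp add: algebra_simps)
    then show ?thesis using DERIV_shift[of "\<lambda>r. g (x + r *\<^sub>R e)" "g' (x + s *\<^sub>R e)" 0 s] by simp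
  qed
  obtain B where B: "\<And>x. \<bar>g' x\<bar> \<le> B" "0 \<le> B"
  proof -
    have "compact (g' ` C)" using C g' by (intro compact_continuous_image continuous_on_subset[OF g']) auto
    then obtain B where B: "\<And>x. x \<in> C \<Longrightarrow> \<bar>g' x\<bar> \<le> B"
      using bounded_iff compact_imp_bounded by (metis image_eqI real_norm_def)
    have "\<bar>g' x\<bar> \<le> max B 0" for x
      using B[of x] C(3)[of x] by (cases "x \<in> C") auto
    then show thesis by (intro that[of "max B 0"]) auto
  qed
  \<comment> \<open>The points that some step r e with 0 <= r <= 1 moves into \<open>C\<close>; off
    this set all the quotients used vanish.\<close>
  define S where "S = (\<lambda>(c, r). c - r *\<^sub>R e) ` (C \<times> {0..1::real})"
  have S: "compact S" unfolding S_def case_prod_unfold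
    using C by (intro compact_continuous_image compact_Times continuous_intros) auto
  have [measurable]: "S \<in> sets borel" using S by (simp add: borel_compact)
  define h where "h n = 1 / real (Suc n)" for n
  have h: "0 < h n" "h n \<le> 1" for n by (auto simp: h_def)
  have hlim: "h \<longlonglongrightarrow> 0" unfolding h_def by (rule LIMSEQ_Suc[OF lim_1_over_n])
  have "(\<lambda>n. \<integral>x. (g (x + h n *\<^sub>R e) - g x) / h n \<partial>lborel) \<longlonglongrightarrow> (\<integral>x. g' x \<partial>lborel)"
  proof (rule integral_dominated_convergence[where w = "\<lambda>x. B * indicator S x"])
    show "integrable lborel (\<lambda>x. B * indicator S x)"
      using emeasure_compact_finite[OF S] by simp
    show "AE x in lborel. (\<lambda>n. (g (x + h n *\<^sub>R e) - g x) / h n) \<longlonglongrightarrow> g' x"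
    proof (rule AE_I2)
      fix x
      have "((\<lambda>s. (g (x + s *\<^sub>R e) - g x) / s) \<longlongrightarrow> g' x) (at 0)"
        using d[of x] by (simp add: has_field_derivative_iff)
      moreover have "filterlim h (at 0) sequentially"
        using hlim less_imp_neq[OF h(1)] by (simp add: filterlim_at)
      ultimately show "(\<lambda>n. (g (x + h n *\<^sub>R e) - g x) / h n) \<longlonglongrightarrow> g' x"
        by (rule filterlim_compose)
    qed
    show "AE x in lborel. norm ((g (x + h n *\<^sub>R e) - g x) / h n) \<le> B * indicator S x" for n
    proof (rule AE_I2)
      fix x
      obtain z where z: "0 < z" "z < h n" "g (x + h n *\<^sub>R e) - g (x + 0 *\<^sub>R e) = (h n - 0) * g' (x + z *\<^sub>R e)"
        using MVT2[OF h(1)[of n], of "\<lambda>s. g (x + s *\<^sub>R e)" "\<lambda>s. g' (x + s *\<^sub>R e)"] d' by blast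
      then have eq: "(g (x + h n *\<^sub>R e) - g x) / h n = g' (x + z *\<^sub>R e)"
        using h(1)[of n] by simp
      show "norm ((g (x + h n *\<^sub>R e) - g x) / h n) \<le> B * indicator S x"
      proof (cases "x \<in> S")
        case True
        then show ?thesis unfolding eq using B by simp
      next
        case False
        have "x + z *\<^sub>R e \<notin> C"
        proof
          assume "x + z *\<^sub>R e \<in> C"
          then have "x \<in> S" unfolding S_def using z h(2)[of n]
            by (intro image_eqI[of _ _ "(x + z *\<^sub>R e, z)"]) auto
          with False show False by simp
        qed
        then show ?thesis unfolding eq using C(3) B by simp
      qed
    qed
  qed auto
  moreover have "(\<integral>x. (g (x + h n *\<^sub>R e) - g x) / h n \<partial>lborel) = 0" for n
    using integrable_lborel_translate[OF gi, of "h n *\<^sub>R e"] gi integral_lborel_translate[of g "h n *\<^sub>R e"]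
    by simp
  ultimately show ?thesis by (simp only: LIMSEQ_const_iff)
qed

text \<open>The integrand is the \<open>i\<close>-th partial derivative of the product g k,
  supported where \<open>g\<close> is.\<close>

lemma testfun_integral_by_parts:
  fixes g k :: "real^'n::finite \<Rightarrow> real"
  assumes g: "testfun D g" and k: "testfun D k"
  shows "(\<integral>x. pd [i] g x * k x + g x * pd [i] k x \<partial>lborel) = 0"
proof -
  have s: "smooth_fun g" "smooth_fun k" using g k by (auto simp: testfun_def)
  have c: "continuous_on UNIV (pd js g)" "continuous_on UNIV (pd js k)" for js
    using s by (auto simp: smooth_fun_def)
  obtain C where C: "compact C" "\<And>x. x \<notin> C \<Longrightarrow> g x = 0" "\<And>x. x \<notin> C \<Longrightarrow> grad g x = 0"
    using testfun_support[OF g] by metis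
  have pd0: "pd [i] g x = 0" if "x \<notin> C" for x
    using arg_cong[OF C(3)[OF that], of "\<lambda>v. v $ i"] by (simp add: grad_def)
  show ?thesis
  proof (rule integral_directional_derivative_zero[where g = "\<lambda>x. g x * k x" and e = "axis i 1" and C = C])
    show "continuous_on UNIV (\<lambda>x. g x * k x)" using c[of "[]"] by (auto intro: continuous_intros)
    show "continuous_on UNIV (\<lambda>x. pd [i] g x * k x + g x * pd [i] k x)"
      using c[of "[]"] c[of "[i]"] unfolding pd.simps(1) by (intro continuous_intros)
    show "((\<lambda>s. g (x + s *\<^sub>R axis i 1) * k (x + s *\<^sub>R axis i 1)) has_real_derivative
        pd [i] g x * k x + g x * pd [i] k x) (at 0)" for x
      using DERIV_mult[OF smooth_fun_has_derivative[OF s(1), of "[]" x i] smooth_fun_has_derivative[OF s(2), of "[]" x i]]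
      by (simp del: pd.simps(2) add: mult.commute)
  qed (use C pd0 in \<open>auto simp del: pd.simps(2)\<close>)
qed

section \<open>A solution of the heat equation\<close>

text \<open>Since the time interval is bounded, domination by a function of \<open>x\<close> alone
  suffices.\<close>

lemma L2Q_slab:
  fixes G :: "(real^'n::finite) \<times> real \<Rightarrow> 'b::euclidean_space" and q :: "real^'n \<Rightarrow> 'c::euclidean_space"
  assumes G: "continuous_on UNIV G" and q: "sq_integrable lborel q"
    and bd: "\<And>x s. 0 < s \<Longrightarrow> s < 1 \<Longrightarrow> norm (G (x, s)) \<le> norm (q x)"
  shows "L2Q (UNIV \<times> {0<..<1}) (\<lambda>x s. G (x, s))"
proof -
  have [measurable]: "G \<in> borel_measurable borel" by (rule borel_measurable_continuous_onI[OF G])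
  have Q [measurable]: "(UNIV \<times> {0<..<1} :: ((real^'n) \<times> real) set) \<in> sets borel"
    by (intro borel_open open_Times) auto
  have "sq_integrable lborel (\<lambda>z. indicator (UNIV \<times> {0<..<1}) z *\<^sub>R G z)"
  proof (rule sq_integrable_bound[OF sq_integrable_fst_indicator[OF q, of "{0<..<1}"], where C = 1])
    show "AE z in lborel. norm (indicator (UNIV \<times> {0<..<1}) z *\<^sub>R G z)
        \<le> 1 * norm (indicator {0<..<1} (snd z) *\<^sub>R q (fst z))"
      using bd by (intro AE_I2) (auto simp: indicator_def)
  qed auto
  then have "set_integrable lborel (UNIV \<times> {0<..<1}) (\<lambda>z. (norm (G z))\<^sup>2)"
    by (subst (asm) sq_integrable_indicator_iff) auto
  then show ?thesis by (simp add: L2Q_def QM_eq_lborel case_prod_unfold)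
qed

definition laplacian :: "(real^'n::finite \<Rightarrow> real) \<Rightarrow> real^'n \<Rightarrow> real" where
  "laplacian \<phi> x = (\<Sum>i\<in>UNIV. pd [i, i] \<phi> x)"

lemma sq_integrable_sum:
  "finite I \<Longrightarrow> (\<And>i. i \<in> I \<Longrightarrow> sq_integrable M (f i)) \<Longrightarrow> sq_integrable M (\<lambda>x. \<Sum>i\<in>I. f i x)"
proof (induction I rule: finite_induct)
  case (insert i I)
  then show ?case using sq_integrable_add[of M "f i" "\<lambda>x. \<Sum>i\<in>I. f i x"] by simp
qed (simp add: sq_integrable_def)

lemma laplacian_sq_integrable:
  assumes "testfun D \<phi>"
  shows "sq_integrable lborel (laplacian \<phi>)"
proof -
  have "sq_integrable lborel (pd [i, i] \<phi>)" for i
    using testfun_sq_integrable(1)[OF testfun_pd[OF testfun_pd[OF assms], of i i]] by simp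
  then show ?thesis unfolding laplacian_def[abs_def] by (intro sq_integrable_sum) auto
qed

text \<open>Integration by parts for each first partial of \<phi> against \<psi>, summed over the
  axes.\<close>

lemma integral_green:
  fixes \<phi> \<psi> :: "real^'n::finite \<Rightarrow> real"
  assumes \<phi>: "testfun D \<phi>" and \<psi>: "testfun D \<psi>"
  shows "(\<integral>x. grad \<phi> x \<bullet> grad \<psi> x + laplacian \<phi> x * \<psi> x \<partial>lborel) = 0"
proof -
  note i1 = testfun_sq_integrable(1)
  have "(\<integral>x. grad \<phi> x \<bullet> grad \<psi> x + laplacian \<phi> x * \<psi> x \<partial>lborel)
      = (\<integral>x. (\<Sum>i\<in>UNIV. pd [i] (pd [i] \<phi>) x * \<psi> x + pd [i] \<phi> x * pd [i] \<psi> x) \<partial>lborel)"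
    by (intro Bochner_Integration.integral_cong)
      (simp_all add: grad_def inner_vec_def laplacian_def sum_distrib_right sum.distrib)
  also have "\<dots> = (\<Sum>i\<in>UNIV. \<integral>x. pd [i] (pd [i] \<phi>) x * \<psi> x + pd [i] \<phi> x * pd [i] \<psi> x \<partial>lborel)"
  proof (rule Bochner_Integration.integral_sum)
    fix i
    show "integrable lborel (\<lambda>x. pd [i] (pd [i] \<phi>) x * \<psi> x + pd [i] \<phi> x * pd [i] \<psi> x)"
      using integrable_inner_sq[OF i1[OF testfun_pd[OF testfun_pd[OF \<phi>, of i], of i]] i1[OF \<psi>]]
        integrable_inner_sq[OF i1[OF testfun_pd[OF \<phi>, of i]] i1[OF testfun_pd[OF \<psi>, of i]]]
      by (simp del: pd.simps)
  qed
  also have "\<dots> = 0"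
    using testfun_integral_by_parts[OF testfun_pd[OF \<phi>] \<psi>] by (simp del: pd.simps)
  finally show ?thesis .
qed

text \<open>The source is found backwards: applying the heat operator to u = s \<phi> gives \<phi> -
  s times the Laplacian of \<phi>.\<close>

lemma heat_solution:
  fixes \<phi> :: "real^'n::finite \<Rightarrow> real"
  assumes \<phi>: "testfun UNIV \<phi>"
  shows "L2Q (UNIV \<times> {0<..<1}) (\<lambda>x s. \<phi> x - s * laplacian \<phi> x)"
    and "is_solution 1 UNIV (\<lambda>_ _. mat 1) (\<lambda>_ _. 0) (\<lambda>_ _. 0) (\<lambda>_ _. 0)
      (\<lambda>x s. \<phi> x - s * laplacian \<phi> x) (\<lambda>x s. s * \<phi> x) (\<lambda>x s. s *\<^sub>R grad \<phi> x)"
proof -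
  have s: "smooth_fun \<phi>" using \<phi> by (simp add: testfun_def)
  have c: "continuous_on UNIV (pd js \<phi>)" for js using s by (auto simp: smooth_fun_def)
  have c0: "continuous_on UNIV \<phi>" using c[of "[]"] by simp
  have cl: "continuous_on UNIV (laplacian \<phi>)"
    unfolding laplacian_def[abs_def] by (intro continuous_intros c)
  note sq = testfun_sq_integrable[OF \<phi>] and sql = laplacian_sq_integrable[OF \<phi>]
  have cf: "continuous_on UNIV (\<lambda>z. h (fst z))" if "continuous_on UNIV h" for h :: "real^'n \<Rightarrow> 'x::topological_space"
    using that by (intro continuous_on_compose2[OF that]) (auto intro: continuous_intros)
  show "L2Q (UNIV \<times> {0<..<1}) (\<lambda>x s. \<phi> x - s * laplacian \<phi> x)"
  proof -
    have "sq_integrable lborel (\<lambda>x. \<bar>\<phi> x\<bar> + \<bar>laplacian \<phi> x\<bar>)"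
      using sq(1) sql by (intro sq_integrable_add) (auto simp: sq_integrable_def)
    then have "L2Q (UNIV \<times> {0<..<1}) (\<lambda>x s. (\<lambda>z. \<phi> (fst z) - snd z * laplacian \<phi> (fst z)) (x, s))"
    proof (rule L2Q_slab[rotated])
      show "continuous_on UNIV (\<lambda>z. \<phi> (fst z) - snd z * laplacian \<phi> (fst z))"
        by (intro continuous_intros cf c0 cl)
      fix x :: "real^'n" and s :: real assume s: "0 < s" "s < 1"
      have "\<bar>s * laplacian \<phi> x\<bar> \<le> \<bar>laplacian \<phi> x\<bar>"
        using s by (simp add: abs_mult mult_left_le_one_le)
      then show "norm (\<phi> (fst (x, s)) - snd (x, s) * laplacian \<phi> (fst (x, s))) \<le> norm (\<bar>\<phi> x\<bar> + \<bar>laplacian \<phi> x\<bar>)"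
        by simp
    qed
    then show ?thesis by simp
  qed
  show "is_solution 1 UNIV (\<lambda>_ _. mat 1) (\<lambda>_ _. 0) (\<lambda>_ _. 0) (\<lambda>_ _. 0)
      (\<lambda>x s. \<phi> x - s * laplacian \<phi> x) (\<lambda>x s. s * \<phi> x) (\<lambda>x s. s *\<^sub>R grad \<phi> x)"
    unfolding is_solution_def
  proof (intro conjI ballI allI impI)
    show "L2Q (UNIV \<times> {0<..<1}) (\<lambda>x s. s * \<phi> x)"
    proof -
      have "continuous_on UNIV (\<lambda>z. snd z * \<phi> (fst z))" by (intro continuous_intros cf c0)
      from L2Q_slab[OF this sq(1)] show ?thesis by (simp add: abs_mult mult_left_le_one_le)
    qed
    show "L2Q (UNIV \<times> {0<..<1}) (\<lambda>x s. s *\<^sub>R grad \<phi> x)"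
    proof -
      have "continuous_on UNIV (\<lambda>z. snd z *\<^sub>R grad \<phi> (fst z))"
        by (intro continuous_intros cf grad_continuous s)
      from L2Q_slab[OF this sq(2)] show ?thesis by (simp add: mult_left_le_one_le)
    qed
    show u2: "set_integrable lborel UNIV (\<lambda>x. (t * \<phi> x)\<^sup>2)" for t
      using sq(1) by (simp add: set_integrable_def power_mult_distrib sq_integrable_def)
    show "AE t in lborel. t \<in> {0<..<1} \<longrightarrow> H10 UNIV (\<lambda>x. t * \<phi> x) (\<lambda>x. t *\<^sub>R grad \<phi> x)"
    proof (intro AE_I2 impI)
      fix t :: real
      have "set_integrable lborel UNIV (\<lambda>x. (norm (t *\<^sub>R grad \<phi> x))\<^sup>2)"
        using sq(2) by (simp add: set_integrable_def power_mult_distrib sq_integrable_def)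
      \<comment> \<open>Each time slice is itself a test function, so a constant sequence
        approximates it.\<close>
      with u2[of t] show "H10 UNIV (\<lambda>x. t * \<phi> x) (\<lambda>x. t *\<^sub>R grad \<phi> x)"
        unfolding H10_def
        by (intro conjI exI[of _ "\<lambda>k x. t * \<phi> x"]) (auto simp: testfun_cmult \<phi> grad_cmult s set_lebesgue_integral_def)
    qed
    show "((\<lambda>r. LINT x:UNIV|lborel. (r * \<phi> x - t * \<phi> x)\<^sup>2) \<longlongrightarrow> 0) (at t within {0..1})" for t
    proof -
      have "(LINT x:UNIV|lborel. (r * \<phi> x - t * \<phi> x)\<^sup>2) = (r - t)\<^sup>2 * (\<integral>x. (\<phi> x)\<^sup>2 \<partial>lborel)" for r
        by (simp add: set_lebesgue_integral_def power_mult_distrib flip: left_diff_distrib)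
      moreover have "((\<lambda>r. (r - t)\<^sup>2 * (\<integral>x. (\<phi> x)\<^sup>2 \<partial>lborel)) \<longlongrightarrow> (t - t)\<^sup>2 * (\<integral>x. (\<phi> x)\<^sup>2 \<partial>lborel)) (at t within {0..1})"
        by (intro tendsto_intros)
      ultimately show ?thesis by simp
    qed
    fix t :: real and \<psi> :: "real^'n \<Rightarrow> real"
    assume t: "t \<in> {0..1}" and \<psi>: "testfun UNIV \<psi>"
    note sq' = testfun_sq_integrable[OF \<psi>]
    define a where "a x = \<phi> x * \<psi> x" for x
    define k where "k x = grad \<phi> x \<bullet> grad \<psi> x + laplacian \<phi> x * \<psi> x" for x
    have ai: "integrable lborel a"
      using integrable_inner_sq[OF sq(1) sq'(1)] by (simp add: a_def[abs_def])
    have ki: "integrable lborel k"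
      using integrable_inner_sq[OF sq(2) sq'(2)] integrable_inner_sq[OF sql sq'(1)]
      by (simp add: k_def[abs_def])
    have k0: "(\<integral>x. k x \<partial>lborel) = 0" unfolding k_def by (rule integral_green[OF \<phi> \<psi>])
    have [measurable]: "k \<in> borel_measurable borel" using ki by auto
    have f1: "integrable lborel (\<lambda>z::(real^'n) \<times> real. a (fst z) * indicator {0<..<t} (snd z))"
      using t by (intro integrable_times_indicator_snd ai) auto
    have f2: "integrable (lborel \<Otimes>\<^sub>M lborel) (\<lambda>(x::real^'n, s). k x * (indicator {0<..<t} s * s))"
    proof -
      have "integrable (lborel \<Otimes>\<^sub>M lborel) (\<lambda>z::(real^'n) \<times> real. k (fst z) * indicator {0<..<t} (snd z))"
        unfolding lborel_prod using t by (intro integrable_times_indicator_snd ki) auto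
      then show ?thesis
        by (rule Bochner_Integration.integrable_bound)
          (use t in \<open>auto intro!: AE_I2 simp: indicator_def abs_mult mult_left_le split: prod.split\<close>)
    qed
    have "(\<integral>z. k (fst z) * (indicator {0<..<t} (snd z) * snd z) \<partial>lborel)
        = (\<integral>s. (\<integral>x. k x * (indicator {0<..<t} s * s) \<partial>lborel) \<partial>lborel)"
      using lborel_pair.integral_snd[OF f2] by (simp add: lborel_prod case_prod_unfold)
    also have "\<dots> = 0" by (simp add: k0)
    finally have 2: "(\<integral>z. k (fst z) * (indicator {0<..<t} (snd z) * snd z) \<partial>lborel) = 0" .
    have "(LINT z:(UNIV \<times> {0<..<t})|QM. (case z of (x, s) \<Rightarrow>
            - ((mat 1 *v (s *\<^sub>R grad \<phi> x)) \<bullet> grad \<psi> x)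
            + (0 \<bullet> (s *\<^sub>R grad \<phi> x) + 0 * (s * \<phi> x)) * \<psi> x
            - 0 \<bullet> grad \<psi> x + (\<phi> x - s * laplacian \<phi> x) * \<psi> x))
       = (\<integral>z. a (fst z) * indicator {0<..<t} (snd z) - k (fst z) * (indicator {0<..<t} (snd z) * snd z) \<partial>lborel)"
      unfolding set_lebesgue_integral_def QM_eq_lborel
      by (intro Bochner_Integration.integral_cong) (auto simp: indicator_def a_def k_def algebra_simps)
    also have "\<dots> = t * (\<integral>x. a x \<partial>lborel)"
      using f1 f2 2 integral_times_indicator_snd[OF ai, of "{0<..<t}"] t
      by (simp add: lborel_prod case_prod_unfold)
    also have "\<dots> = (LINT x:UNIV|lborel. t * \<phi> x * \<psi> x)"
      by (simp add: set_lebesgue_integral_def a_def mult.assoc)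
    finally show "(LINT x:UNIV|lborel. t * \<phi> x * \<psi> x) = (LINT z:(UNIV \<times> {0<..<t})|QM. (case z of (x, s) \<Rightarrow>
            - ((mat 1 *v (s *\<^sub>R grad \<phi> x)) \<bullet> grad \<psi> x)
            + (0 \<bullet> (s *\<^sub>R grad \<phi> x) + 0 * (s * \<phi> x)) * \<psi> x
            - 0 \<bullet> grad \<psi> x + (\<phi> x - s * laplacian \<phi> x) * \<psi> x))" ..
  qed
qed

text \<open>The heat equation on the whole space, a choice of domain that works in every dimension
  without any boundary.\<close>

definition heat_data :: "('n::finite) data" where
  "heat_data = (1, UNIV, 1, \<lambda>_ _. mat 1, \<lambda>_ _. 0, \<lambda>_ _. 0)"

lemma admissible_heat_data: "admissible (heat_data :: ('n::finite) data)"
proof -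
  have "esssupQ (UNIV \<times> {0<..<1}) (\<lambda>(x, t). norm (mat 1 :: real^'n^'n)
      + norm (matrix_inv (mat 1 :: real^'n^'n)) + norm (0::real^'n) + \<bar>0\<bar>)
      \<le> ereal (norm (mat 1 :: real^'n^'n) + norm (matrix_inv (mat 1 :: real^'n^'n)))"
    unfolding esssupQ_def by (intro Inf_lower) simp
  also have "\<dots> < \<infinity>" by simp
  finally show ?thesis
    by (simp add: admissible_def heat_data_def case_prod_unfold power2_norm_eq_inner)
qed

text \<open>The set where \<open>g\<close> does not vanish is open and nonempty, hence not a null
  set.\<close>

lemma continuous_square_integral_pos:
  fixes g :: "'a::euclidean_space \<Rightarrow> real"
  assumes g: "continuous_on UNIV g" "integrable lborel (\<lambda>x. (g x)\<^sup>2)" and y: "g y \<noteq> 0"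
  shows "0 < (\<integral>x. (g x)\<^sup>2 \<partial>lborel)"
proof -
  have "(\<integral>x. (g x)\<^sup>2 \<partial>lborel) \<noteq> 0"
  proof
    assume "(\<integral>x. (g x)\<^sup>2 \<partial>lborel) = 0"
    then have ae: "AE x in lborel. g x = 0"
      using integral_nonneg_eq_0_iff_AE[OF g(2)] by simp
    have o: "open {x. g x \<noteq> 0}"
      using open_Collect_neq[OF g(1) continuous_on_const, of 0] by simp
    have "{x. g x \<noteq> 0} \<in> null_sets lborel"
      using ae o by (subst (asm) AE_iff_null_sets[symmetric, of "{x. g x \<noteq> 0}", simplified]) auto
    then have "negligible {x. g x \<noteq> 0}"
      by (simp add: negligible_iff_null_sets null_sets_completionI)
    with open_not_negligible[OF o] y show False by blast
  qed
  moreover have "0 \<le> (\<integral>x. (g x)\<^sup>2 \<partial>lborel)" by simp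
  ultimately show ?thesis by linarith
qed

text \<open>Taking F = 0 eliminates \<open>c1\<close>, so no large first constant can compensate a
  negative \<open>c0\<close>: the left side is positive at t = 1 and the integral multiplying
  \<open>c0\<close> is nonnegative.\<close>

lemma energy_ok_heat_nonneg:
  assumes "energy_ok K M (Pof (heat_data :: ('n::finite) data)) c1 c0" and M: "0 \<le> M"
  shows "0 \<le> c0"
proof -
  define \<phi> :: "real^'n \<Rightarrow> real" where "\<phi> = bump"
  have \<phi>: "testfun UNIV \<phi>" unfolding \<phi>_def by (rule testfun_bump)
  have z: "L2Q (UNIV \<times> {0<..<1}) (\<lambda>(_::real^'n) _. 0::real^'n)"
    by (simp add: L2Q_def set_integrable_def)
  define X where "X = (LINT z:(UNIV \<times> {0<..<1})|QM. (case z of (x, s) \<Rightarrow>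
      exp (- 2 * K * s) * (\<phi> x - s * laplacian \<phi> x)\<^sup>2))"
  define Y where "Y = (LINT z:(UNIV \<times> {0<..<1})|QM. (case z of (x, s) \<Rightarrow> exp (- 2 * K * s) * (s * \<phi> x)\<^sup>2))"
  have XY: "0 \<le> X" "0 \<le> Y"
    unfolding X_def Y_def set_lebesgue_integral_def by (auto intro!: integral_nonneg_AE)
  note E = assms(1)[unfolded energy_ok_def, THEN spec, of heat_data, THEN mp, OF conjI[OF admissible_heat_data refl],
      unfolded heat_data_def prod.case, THEN spec, THEN spec, THEN spec, THEN spec, THEN mp,
      OF conjI[OF z conjI[OF heat_solution[OF \<phi>]]], THEN bspec, of 1]
  have "exp (- 2 * K) * (\<integral>x. (\<phi> x)\<^sup>2 \<partial>lborel) + M * Y \<le> c0 * X"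
    using E by (simp add: X_def Y_def set_lebesgue_integral_def case_prod_unfold)
  moreover have "0 < (\<integral>x. (\<phi> x)\<^sup>2 \<partial>lborel)"
  proof (rule continuous_square_integral_pos)
    show "continuous_on UNIV \<phi>" using \<phi> unfolding testfun_def smooth_fun_def by (metis pd.simps(1))
    show "integrable lborel (\<lambda>x. (\<phi> x)\<^sup>2)" using testfun_sq_integrable(1)[OF \<phi>] by (simp add: sq_integrable_def)
    show "\<phi> (\<chi> i. 1/2) \<noteq> 0" unfolding \<phi>_def by (rule bump_nonzero)
  qed
  ultimately have "0 < c0 * X"
    using M XY by (smt (verit) exp_gt_zero mult_nonneg_nonneg mult_pos_pos)
  then show ?thesis using XY by (simp add: zero_less_mult_iff)
qed

theorem theorem3p1:
  shows "(SUP p \<in> {(\<mu>::('n::finite) data, M::real). admissible \<mu> \<and> M \<ge> 0}.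
            INF K \<in> {0::real..}. C1 K (snd p) (Pof (fst p))) \<le> ereal (1/2) \<and>
         (SUP p \<in> {(\<mu>::('n::finite) data, M::real). admissible \<mu> \<and> M \<ge> 0}.
            INF K \<in> {0::real..}. C0 K (snd p) (Pof (fst p))) = 0"
proof (intro conjI antisym)
  show "(SUP p \<in> {(\<mu>::'n data, M::real). admissible \<mu> \<and> M \<ge> 0}.
            INF K \<in> {0::real..}. C1 K (snd p) (Pof (fst p))) \<le> ereal (1/2)"
  proof (rule SUP_least, clarsimp)
    fix \<mu> :: "'n data" and M :: real assume a: "admissible \<mu>" "0 \<le> M"
    show "(INF K \<in> {0..}. C1 K M (Pof \<mu>)) \<le> ereal (1/2)"
    \<comment> \<open>The \<open>K\<close> realizing 1/2 + \<epsilon> varies with \<epsilon>; the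
      infimum over \<open>K\<close> permits this.\<close>
    proof (rule ereal_le_epsilon2)
      fix \<epsilon> :: real assume "0 < \<epsilon>"
      from ex_energy_ok[OF a this] obtain K where K: "0 \<le> K" "energy_ok K M (Pof \<mu>) (1/2 + \<epsilon>) \<epsilon>" by blast
      have "(INF K \<in> {0..}. C1 K M (Pof \<mu>)) \<le> C1 K M (Pof \<mu>)" using K by (intro INF_lower) auto
      also have "\<dots> \<le> ereal (1/2 + \<epsilon>)" unfolding C1_def using K by (intro Inf_lower) blast
      finally show "(INF K \<in> {0..}. C1 K M (Pof \<mu>)) \<le> ereal (1/2) + ereal \<epsilon>" by simp
    qed
  qed
  show "(SUP p \<in> {(\<mu>::'n data, M::real). admissible \<mu> \<and> M \<ge> 0}.
            INF K \<in> {0::real..}. C0 K (snd p) (Pof (fst p))) \<le> 0"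
  proof (rule SUP_least, clarsimp)
    fix \<mu> :: "'n data" and M :: real assume a: "admissible \<mu>" "0 \<le> M"
    show "(INF K \<in> {0..}. C0 K M (Pof \<mu>)) \<le> 0"
    proof (rule ereal_le_epsilon2)
      fix \<epsilon> :: real assume "0 < \<epsilon>"
      from ex_energy_ok[OF a this] obtain K where K: "0 \<le> K" "energy_ok K M (Pof \<mu>) (1/2 + \<epsilon>) \<epsilon>" by blast
      have "(INF K \<in> {0..}. C0 K M (Pof \<mu>)) \<le> C0 K M (Pof \<mu>)" using K by (intro INF_lower) auto
      also have "\<dots> \<le> ereal \<epsilon>" unfolding C0_def using K by (intro Inf_lower) blast
      finally show "(INF K \<in> {0..}. C0 K M (Pof \<mu>)) \<le> 0 + ereal \<epsilon>" by simp
    qed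
  qed
  show "0 \<le> (SUP p \<in> {(\<mu>::'n data, M::real). admissible \<mu> \<and> M \<ge> 0}.
            INF K \<in> {0::real..}. C0 K (snd p) (Pof (fst p)))"
  \<comment> \<open>A single datum bounds the supremum from below; for it every admissible second
    constant is nonnegative, whatever \<open>K\<close> is.\<close>
  proof (rule SUP_upper2[of "(heat_data, 0)"])
    show "(heat_data :: 'n data, 0::real) \<in> {(\<mu>, M). admissible \<mu> \<and> M \<ge> 0}"
      using admissible_heat_data by simp
    show "0 \<le> (INF K \<in> {0::real..}. C0 K (snd (heat_data :: 'n data, 0)) (Pof (fst (heat_data :: 'n data, 0::real))))"
      unfolding C0_def
      by (intro INF_greatest Inf_greatest) (use energy_ok_heat_nonneg in fastforce)
  qed
qed

end
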